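(* Let $f(x_1,\dots,x_n)$ be a real analytic (real-valued) function on a neighborhood of the origin in $\mathbb{R}^n$, not identically zero. Then there are an $\eta>0$ and a positive integer $p$ such that if $(x_1,\dots,x_{n-1})\in B_{n-1}(0,\eta)$ and $s\in\mathbb{R}$, then either $f(x_1,\dots,x_n)=s$ for all $|x_n|<\eta$, or the equation $f(x_1,\dots,x_n)=s$ has at most $p$ solutions $x_n$ with $|x_n|<\eta$.
   Context: $B_{n-1}(0,\eta)$ denotes the open ball of radius $\eta$ centered at the origin in $\mathbb{R}^{n-1}$. It is understood that $\eta$ is small enough that $B_{n-1}(0,\eta)\times(-\eta,\eta)$ lies in the domain of $f$. *)

theory Defs
  imports "HOL-Analysis.Analysis"
begin

(* A multi-index is a function \<alpha> :: 'n => nat on the finite index type. The family of monomials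
   is summed with has_sum (unconditional, hence absolute, convergence), so that no enumeration
   of the multi-indices has to be chosen. *)

definition real_analytic_at :: "(real ^ 'n \<Rightarrow> real) \<Rightarrow> real ^ 'n \<Rightarrow> bool" where
  "real_analytic_at f a \<longleftrightarrow>
     (\<exists>r > 0. \<exists>c :: ('n \<Rightarrow> nat) \<Rightarrow> real. \<forall>x \<in> ball a r.
        ((\<lambda>\<alpha>. c \<alpha> * (\<Prod>i\<in>UNIV. (x $ i - a $ i) ^ \<alpha> i)) has_sum f x) UNIV)"

(* Functions are total; for open U the values of f outside U are irrelevant, because the
   radius r above can be shrunk until the ball lies in U. *)

definition real_analytic_on :: "(real ^ 'n \<Rightarrow> real) \<Rightarrow> (real ^ 'n) set \<Rightarrow> bool" where
  "real_analytic_on f U \<longleftrightarrow> (\<forall>a\<in>U. real_analytic_at f a)"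

(* With n = CARD('n), the hyperplane {y. y $ k = 0} is isometric to R^(n-1) by omitting the
   coordinate k, and base_ball k \<eta> corresponds to the open ball of radius \<eta> about 0 in R^(n-1).
   A type of dimension n - 1 would not cover n = 1, where base_ball k \<eta> is {0}.
   The point (y, t) of R^(n-1) x R is y + axis k t. *)

definition base_ball :: "'n \<Rightarrow> real \<Rightarrow> (real ^ 'n) set" where
  "base_ball k \<eta> = {y \<in> ball 0 \<eta>. y $ k = 0}"

end

theory Submission
  imports Defs "HOL-Computational_Algebra.Primes"
begin

text \<open>
  Write $f(y,t) = \sum_j a_j(y) t^j$. The theorem follows from a uniform estimate
  $|a_j(y)| \le C D^j \max_{1 \le i \le K} |a_i(y)|$ for all $j \ge 1$ and all small $y$: if some $a_q(y)$
  with $1 \le q \le K$ is of maximal modulus and nonzero, then the $q$-th derivative of $f(y,\cdot)$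
  has no zero on a small interval independent of $y$, and Rolle's theorem bounds the number of
  solutions by $q$; otherwise $f(y,\cdot)$ is constant.

  The estimate comes from division with respect to a standard basis. Multi-indices are ordered by
  the integer $\prod_i p_i^{\alpha_i}$ for distinct primes $p_i$, and on the polydisc of radii $p_i^{-s}$ the
  leading monomial of a convergent series dominates the rest once $s$ is large. The series that are
  bounded by a multiple of $\max_{1 \le i \le K} |a_i|$ for some $K$ form an ideal; by Dickson's lemma
  finitely many of its elements generate all its leading exponents. Dividing $a_j$ by them leaves
  a remainder in the ideal without any leading exponent of the ideal, so the remainder vanishes, and
  the quotients are controlled by the norm of $a_j$.
\<close>

section \<open>Weighted power series\<close>

text \<open>The index type carries no enumeration, so the primes are selected by choice; any
  injective family serves.\<close>

definition index_prime :: "'n::finite \<Rightarrow> nat" where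
  "index_prime = (SOME p. inj p \<and> (\<forall>i. prime (p i)))"

lemma index_prime: "inj (index_prime :: 'n::finite \<Rightarrow> nat)" "prime (index_prime (i::'n))"
proof -
  obtain B :: "nat set" where B: "finite B" "card B = CARD('n)" "B \<subseteq> {p. prime p}"
    using infinite_arbitrarily_large[OF primes_infinite] by blast
  then obtain p :: "'n \<Rightarrow> nat" where "bij_betw p UNIV B"
    using finite_same_card_bij[of "UNIV :: 'n set" B] by auto
  then have "\<exists>p :: 'n \<Rightarrow> nat. inj p \<and> (\<forall>i. prime (p i))"
    using B(3) by (intro exI[of _ p]) (auto simp: bij_betw_def)
  then have "inj (index_prime :: 'n \<Rightarrow> nat) \<and> (\<forall>i::'n. prime (index_prime i))"
    unfolding index_prime_def by (rule someI_ex)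
  then show "inj (index_prime :: 'n::finite \<Rightarrow> nat)" "prime (index_prime (i::'n))" by auto
qed

text \<open>Its logarithm is the weighted degree with weights log p_i, which are linearly
  independent over the rationals. The induced order on exponents is total, compatible with addition,
  and has finite initial segments, so recursion along it is available.\<close>

definition godel :: "('n::finite \<Rightarrow> nat) \<Rightarrow> nat" where
  "godel \<alpha> = (\<Prod>i\<in>UNIV. index_prime i ^ \<alpha> i)"

lemma godel_pos: "godel \<alpha> > 0"
  by (simp add: godel_def prime_gt_0_nat[OF index_prime(2)] prod_pos)

lemma godel_add: "godel (\<lambda>i. \<alpha> i + \<beta> i) = godel \<alpha> * godel \<beta>"
  by (simp add: godel_def power_add prod.distrib)

text \<open>Unique factorization: the exponent at \<open>i\<close> is recovered as the multiplicity
  of the prime \<open>index_prime i\<close>.\<close>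

lemma inj_godel: "inj (godel :: ('n::finite \<Rightarrow> nat) \<Rightarrow> nat)"
proof (rule injI)
  fix \<alpha> \<beta> :: "'n \<Rightarrow> nat"
  let ?q = "inv (index_prime :: 'n \<Rightarrow> nat)"
  have inv: "?q (index_prime i) = i" for i :: 'n using index_prime(1)[where 'n = 'n] by (simp add: inv_f_f)
  have "multiplicity (index_prime i) (godel \<gamma>) = \<gamma> i" for i :: 'n and \<gamma> :: "'n \<Rightarrow> nat"
  proof -
    have "godel \<gamma> = (\<Prod>p\<in>range (index_prime :: 'n \<Rightarrow> nat). p ^ \<gamma> (?q p))"
      unfolding godel_def by (subst prod.reindex) (auto simp: index_prime(1) inv)
    show ?thesis
      unfolding \<open>godel \<gamma> = _\<close>
      by (subst multiplicity_prod_prime_powers[where S = "range (index_prime :: 'n \<Rightarrow> nat)" and f = "\<lambda>p. \<gamma> (?q p)"])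
         (auto simp: index_prime(2) inv)
  qed
  then show "godel \<alpha> = godel \<beta> \<Longrightarrow> \<alpha> = \<beta>" by (metis ext)
qed

lemma finite_godel_less: "finite {\<alpha>::'n::finite \<Rightarrow> nat. godel \<alpha> < L}"
  using finite_vimageI[OF finite_lessThan[of L] inj_godel] by (simp add: vimage_def)

text \<open>The value of the monomial at the corner of \<open>polybox s\<close>, the point with
  coordinates p_i^(-s). Increasing \<open>s\<close> separates the weights of exponents with
  different \<open>godel\<close> values.\<close>

definition wt :: "nat \<Rightarrow> ('n::finite \<Rightarrow> nat) \<Rightarrow> real" where
  "wt s \<alpha> = 1 / real (godel \<alpha>) ^ s"

definition conv :: "nat \<Rightarrow> (('n::finite \<Rightarrow> nat) \<Rightarrow> real) \<Rightarrow> bool" where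
  "conv s g \<longleftrightarrow> (\<lambda>\<alpha>. \<bar>g \<alpha>\<bar> * wt s \<alpha>) summable_on UNIV"

definition wnorm :: "nat \<Rightarrow> (('n::finite \<Rightarrow> nat) \<Rightarrow> real) \<Rightarrow> real" where
  "wnorm s g = (\<Sum>\<^sub>\<infinity>\<alpha>. \<bar>g \<alpha>\<bar> * wt s \<alpha>)"

definition monomial :: "real ^ 'n \<Rightarrow> ('n::finite \<Rightarrow> nat) \<Rightarrow> real" where
  "monomial x \<alpha> = (\<Prod>i\<in>UNIV. x $ i ^ \<alpha> i)"

definition pseries :: "(('n::finite \<Rightarrow> nat) \<Rightarrow> real) \<Rightarrow> real ^ 'n \<Rightarrow> real" where
  "pseries g x = (\<Sum>\<^sub>\<infinity>\<alpha>. g \<alpha> * monomial x \<alpha>)"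

definition polybox :: "nat \<Rightarrow> (real ^ 'n::finite) set" where
  "polybox s = {x. \<forall>i. \<bar>x $ i\<bar> \<le> 1 / real (index_prime i) ^ s}"

lemma wt_pos: "wt s \<alpha> > 0"
  by (simp add: wt_def godel_pos)

lemma wt_nonneg [simp]: "wt s \<alpha> \<ge> 0"
  by (simp add: wt_def)

lemma wt_add: "wt s (\<lambda>i. \<alpha> i + \<beta> i) = wt s \<alpha> * wt s \<beta>"
  by (simp add: wt_def godel_add power_mult_distrib)

lemma wt_mono:
  assumes "s \<le> s'"
  shows "wt s' \<alpha> \<le> wt s \<alpha>"
  unfolding wt_def using godel_pos[of \<alpha>] assms
  by (intro divide_left_mono power_increasing mult_pos_pos zero_less_power) auto

lemma polybox_mono:
  assumes "s \<le> s'"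
  shows "polybox s' \<subseteq> polybox s"
proof
  fix x :: "real ^ 'n" assume x: "x \<in> polybox s'"
  have "1 / real (index_prime i) ^ s' \<le> 1 / real (index_prime i) ^ s" for i :: 'n
    using prime_gt_0_nat[OF index_prime(2)[of i]] assms
    by (intro divide_left_mono power_increasing mult_pos_pos zero_less_power) auto
  with x show "x \<in> polybox s" unfolding polybox_def by (auto intro: order_trans)
qed

lemma monomial_add: "monomial x (\<lambda>i. \<alpha> i + \<beta> i) = monomial x \<alpha> * monomial x \<beta>"
  by (simp add: monomial_def power_add prod.distrib)

lemma abs_monomial_le:
  assumes "x \<in> polybox s"
  shows "\<bar>monomial x \<alpha>\<bar> \<le> wt s \<alpha>"
proof -
  have "\<bar>monomial x \<alpha>\<bar> = (\<Prod>i\<in>UNIV. \<bar>x $ i\<bar> ^ \<alpha> i)"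
    by (simp add: monomial_def abs_prod power_abs)
  also have "\<dots> \<le> (\<Prod>i\<in>UNIV. (1 / real (index_prime i) ^ s) ^ \<alpha> i)"
    using assms by (intro prod_mono) (auto simp: polybox_def intro!: power_mono)
  also have "\<dots> = (\<Prod>i\<in>UNIV. 1 / (real (index_prime i) ^ \<alpha> i) ^ s)"
    by (simp add: power_one_over power_mult[symmetric] mult.commute)
  also have "\<dots> = wt s \<alpha>"
    by (simp add: wt_def godel_def prod_dividef prod_power_distrib)
  finally show ?thesis .
qed

lemma wnorm_nonneg: "wnorm s g \<ge> 0"
  unfolding wnorm_def by (intro infsum_nonneg) simp

lemma conv_mono:
  assumes "conv s g" "s \<le> s'"
  shows "conv s' g"
  unfolding conv_def
  by (rule summable_on_comparison_test[OF assms(1)[unfolded conv_def]])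
     (auto intro!: mult_left_mono wt_mono assms(2))

lemma conv_add:
  assumes "conv s g" "conv s h"
  shows "conv s (\<lambda>\<alpha>. g \<alpha> + h \<alpha>)"
  unfolding conv_def
  by (rule summable_on_comparison_test[OF summable_on_add[OF assms[unfolded conv_def]]])
     (auto simp: distrib_right[symmetric] intro!: mult_right_mono)

lemma pseries_abs_summable:
  assumes "conv s g" "x \<in> polybox s"
  shows "(\<lambda>\<alpha>. norm (g \<alpha> * monomial x \<alpha>)) summable_on UNIV"
  by (rule summable_on_comparison_test[OF assms(1)[unfolded conv_def]])
     (auto simp: abs_mult intro!: mult_left_mono abs_monomial_le assms(2))

lemma pseries_summable:
  assumes "conv s g" "x \<in> polybox s"
  shows "(\<lambda>\<alpha>. g \<alpha> * monomial x \<alpha>) summable_on UNIV"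
  using pseries_abs_summable[OF assms] by (rule abs_summable_summable)

lemma pseries_add:
  assumes "conv s g" "conv s h" "x \<in> polybox s"
  shows "pseries (\<lambda>\<alpha>. g \<alpha> + h \<alpha>) x = pseries g x + pseries h x"
  using infsum_add[OF pseries_summable[OF assms(1,3)] pseries_summable[OF assms(2,3)]]
  by (simp add: pseries_def distrib_right)

section \<open>Division by series with prescribed leading exponents\<close>

text \<open>Solves the triangular system which says that h - sum_\<beta> w_\<beta> (x^\<beta> +
  T_\<beta>), summed over \<beta> in \<open>E\<close>, has no exponent in \<open>E\<close>. Every
  exponent of \<open>E\<close> has its own divisor and a scalar quotient w_\<beta>, instead of
  finitely many divisors with series as quotients.\<close>

function quot :: "('n::finite \<Rightarrow> nat) set \<Rightarrow> (('n \<Rightarrow> nat) \<Rightarrow> ('n \<Rightarrow> nat) \<Rightarrow> real) \<Rightarrow>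
    (('n \<Rightarrow> nat) \<Rightarrow> real) \<Rightarrow> ('n \<Rightarrow> nat) \<Rightarrow> real" where
  "quot E T h \<gamma> = (if \<gamma> \<in> E
     then h \<gamma> - (\<Sum>\<beta>\<in>{\<beta>\<in>E. godel \<beta> < godel \<gamma>}. quot E T h \<beta> * T \<beta> \<gamma>) else 0)"
  by pat_completeness auto
termination by (relation "Wellfounded.measure (\<lambda>(E, T, h, \<gamma>). godel \<gamma>)") auto

declare quot.simps [simp del]

lemma quot_notin: "\<gamma> \<notin> E \<Longrightarrow> quot E T h \<gamma> = 0"
  by (simp add: quot.simps)

lemma sum_le_wnorm:
  assumes "conv s g" "finite A"
  shows "(\<Sum>\<alpha>\<in>A. \<bar>g \<alpha>\<bar> * wt s \<alpha>) \<le> wnorm s g"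
  using assms unfolding conv_def wnorm_def by (intro finite_sum_le_infsum) auto

text \<open>A Neumann-type estimate: sending w to sum_\<alpha> w_\<alpha> T_\<alpha> has norm at
  most 1/2 in the weighted l1 norm, for w supported on \<open>E\<close>.\<close>

lemma quot_conv:
  assumes T0: "\<And>\<alpha> \<gamma>. \<alpha> \<in> E \<Longrightarrow> T \<alpha> \<gamma> \<noteq> 0 \<Longrightarrow> godel \<alpha> < godel \<gamma>"
    and T1: "\<And>\<alpha>. \<alpha> \<in> E \<Longrightarrow> conv s (T \<alpha>)"
    and T2: "\<And>\<alpha>. \<alpha> \<in> E \<Longrightarrow> wnorm s (T \<alpha>) \<le> wt s \<alpha> / 2"
    and h: "conv s h"
  shows "conv s (quot E T h)" "wnorm s (quot E T h) \<le> 2 * wnorm s h"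
proof -
  define w where "w = quot E T h"
  \<comment> \<open>These truncations are finite and closed under the recursion, so the estimate can
    be made before any convergence is known.\<close>
  define EL where "EL L = {\<alpha>\<in>E. godel \<alpha> < L}" for L
  have finEL: "finite (EL L)" for L
    unfolding EL_def by (rule finite_subset[OF _ finite_godel_less[of L]]) auto
  have bound: "(\<Sum>\<alpha>\<in>EL L. \<bar>w \<alpha>\<bar> * wt s \<alpha>) \<le> 2 * wnorm s h" for L
  proof -
    let ?S = "\<Sum>\<alpha>\<in>EL L. \<bar>w \<alpha>\<bar> * wt s \<alpha>"
    have "\<bar>w \<alpha>\<bar> * wt s \<alpha> \<le> \<bar>h \<alpha>\<bar> * wt s \<alpha> + (\<Sum>\<beta>\<in>EL L. \<bar>w \<beta>\<bar> * (\<bar>T \<beta> \<alpha>\<bar> * wt s \<alpha>))"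
      if "\<alpha> \<in> EL L" for \<alpha>
    proof -
      have sub: "EL (godel \<alpha>) \<subseteq> EL L" using that by (auto simp: EL_def)
      have "w \<alpha> = h \<alpha> - (\<Sum>\<beta>\<in>EL (godel \<alpha>). w \<beta> * T \<beta> \<alpha>)"
        using that unfolding w_def EL_def by (subst quot.simps) auto
      then have "\<bar>w \<alpha>\<bar> \<le> \<bar>h \<alpha>\<bar> + \<bar>\<Sum>\<beta>\<in>EL (godel \<alpha>). w \<beta> * T \<beta> \<alpha>\<bar>" by linarith
      also have "\<bar>\<Sum>\<beta>\<in>EL (godel \<alpha>). w \<beta> * T \<beta> \<alpha>\<bar> \<le> (\<Sum>\<beta>\<in>EL (godel \<alpha>). \<bar>w \<beta>\<bar> * \<bar>T \<beta> \<alpha>\<bar>)"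
        by (rule order_trans[OF sum_abs]) (simp add: abs_mult)
      also have "\<dots> \<le> (\<Sum>\<beta>\<in>EL L. \<bar>w \<beta>\<bar> * \<bar>T \<beta> \<alpha>\<bar>)"
        by (rule sum_mono2[OF finEL sub]) simp
      finally have "\<bar>w \<alpha>\<bar> \<le> \<bar>h \<alpha>\<bar> + (\<Sum>\<beta>\<in>EL L. \<bar>w \<beta>\<bar> * \<bar>T \<beta> \<alpha>\<bar>)" by simp
      then have "\<bar>w \<alpha>\<bar> * wt s \<alpha> \<le> (\<bar>h \<alpha>\<bar> + (\<Sum>\<beta>\<in>EL L. \<bar>w \<beta>\<bar> * \<bar>T \<beta> \<alpha>\<bar>)) * wt s \<alpha>"
        by (rule mult_right_mono) simp
      then show ?thesis by (simp add: distrib_right sum_distrib_right mult.assoc)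
    qed
    then have "?S \<le> (\<Sum>\<alpha>\<in>EL L. \<bar>h \<alpha>\<bar> * wt s \<alpha> + (\<Sum>\<beta>\<in>EL L. \<bar>w \<beta>\<bar> * (\<bar>T \<beta> \<alpha>\<bar> * wt s \<alpha>)))"
      by (rule sum_mono)
    also have "\<dots> = (\<Sum>\<alpha>\<in>EL L. \<bar>h \<alpha>\<bar> * wt s \<alpha>)
        + (\<Sum>\<beta>\<in>EL L. \<bar>w \<beta>\<bar> * (\<Sum>\<alpha>\<in>EL L. \<bar>T \<beta> \<alpha>\<bar> * wt s \<alpha>))"
      by (simp add: sum.distrib sum_distrib_left, rule sum.swap)
    \<comment> \<open>By \<open>T2\<close> at most half of \<open>?S\<close> comes back. Since
      \<open>?S\<close> is a finite sum, it can be absorbed on the left, which produces the factor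
      2.\<close>
    also have "\<dots> \<le> wnorm s h + (\<Sum>\<beta>\<in>EL L. \<bar>w \<beta>\<bar> * (wt s \<beta> / 2))"
    proof (intro add_mono sum_mono mult_left_mono sum_le_wnorm h finEL)
      fix \<beta> assume "\<beta> \<in> EL L"
      then have "\<beta> \<in> E" by (simp add: EL_def)
      then show "(\<Sum>\<alpha>\<in>EL L. \<bar>T \<beta> \<alpha>\<bar> * wt s \<alpha>) \<le> wt s \<beta> / 2"
        using sum_le_wnorm[OF T1 finEL] T2 by (blast intro: order_trans)
    qed simp
    also have "\<dots> = wnorm s h + ?S / 2" by (simp add: sum_divide_distrib)
    finally show ?thesis by simp
  qed
  have bound': "(\<Sum>\<alpha>\<in>A. \<bar>w \<alpha>\<bar> * wt s \<alpha>) \<le> 2 * wnorm s h" if A: "finite A" for A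
  proof -
    obtain L where L: "\<forall>\<alpha>\<in>A. godel \<alpha> < L"
      using finite_nat_set_iff_bounded[THEN iffD1, OF finite_imageI[OF A, of godel]] by auto
    have "(\<Sum>\<alpha>\<in>A. \<bar>w \<alpha>\<bar> * wt s \<alpha>) = (\<Sum>\<alpha>\<in>A \<inter> E. \<bar>w \<alpha>\<bar> * wt s \<alpha>)"
      using that by (intro sum.mono_neutral_right) (auto simp: w_def quot_notin)
    also have "\<dots> \<le> (\<Sum>\<alpha>\<in>EL L. \<bar>w \<alpha>\<bar> * wt s \<alpha>)"
      using L finEL by (intro sum_mono2) (auto simp: EL_def)
    finally show ?thesis using bound[of L] by linarith
  qed
  then have "conv s w"
    unfolding conv_def by (intro nonneg_bdd_above_summable_on) (auto intro!: bdd_aboveI2)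
  moreover from this have "wnorm s w \<le> 2 * wnorm s h"
    unfolding conv_def wnorm_def[of s w] using bound' by (intro infsum_le_finite_sums) auto
  ultimately show "conv s (quot E T h)" "wnorm s (quot E T h) \<le> 2 * wnorm s h"
    by (auto simp: w_def)
qed

text \<open>Fubini for the double family indexed by \<alpha> and \<gamma>. Summing its weighted
  absolute values over \<gamma> first leaves at most C |w_\<alpha>| \<open>wt s \<alpha>\<close>,
  which is summable; on the polybox the same majorant controls the evaluated terms.\<close>

lemma pseries_infsum_swap:
  assumes w: "conv s w"
    and T1: "\<And>\<alpha>. conv s (T \<alpha>)" and T2: "\<And>\<alpha>. wnorm s (T \<alpha>) \<le> C * wt s \<alpha>"
  shows "conv s (\<lambda>\<gamma>. \<Sum>\<^sub>\<infinity>\<alpha>. w \<alpha> * T \<alpha> \<gamma>)"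
    and "x \<in> polybox s \<Longrightarrow> (\<lambda>\<alpha>. w \<alpha> * pseries (T \<alpha>) x) summable_on UNIV"
    and "x \<in> polybox s \<Longrightarrow>
      pseries (\<lambda>\<gamma>. \<Sum>\<^sub>\<infinity>\<alpha>. w \<alpha> * T \<alpha> \<gamma>) x = (\<Sum>\<^sub>\<infinity>\<alpha>. w \<alpha> * pseries (T \<alpha>) x)"
proof -
  let ?D = "\<lambda>(\<alpha>, \<gamma>). \<bar>w \<alpha>\<bar> * (\<bar>T \<alpha> \<gamma>\<bar> * wt s \<gamma>)"
  have D1: "(\<lambda>\<gamma>. \<bar>w \<alpha>\<bar> * (\<bar>T \<alpha> \<gamma>\<bar> * wt s \<gamma>)) summable_on UNIV" for \<alpha>
    using T1[of \<alpha>] unfolding conv_def by (rule summable_on_cmult_right)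
  have D2: "(\<Sum>\<^sub>\<infinity>\<gamma>. \<bar>w \<alpha>\<bar> * (\<bar>T \<alpha> \<gamma>\<bar> * wt s \<gamma>)) = \<bar>w \<alpha>\<bar> * wnorm s (T \<alpha>)" for \<alpha>
    using T1[of \<alpha>] unfolding conv_def wnorm_def by (intro infsum_cmult_right) auto
  have "(\<lambda>\<alpha>. \<bar>w \<alpha>\<bar> * wnorm s (T \<alpha>)) summable_on UNIV"
  proof (rule summable_on_comparison_test[OF summable_on_cmult_right[OF w[unfolded conv_def], of C]])
    show "\<bar>w \<alpha>\<bar> * wnorm s (T \<alpha>) \<le> C * (\<bar>w \<alpha>\<bar> * wt s \<alpha>)" for \<alpha>
      using mult_left_mono[OF T2[of \<alpha>], of "\<bar>w \<alpha>\<bar>"] by (simp add: mult_ac)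
  qed (simp add: wnorm_nonneg)
  then have "(\<lambda>z. norm (?D z)) summable_on UNIV \<times> UNIV"
    using D1 by (subst Infinite_Sum.abs_summable_on_Sigma_iff)
      (auto simp: abs_mult D2 wnorm_nonneg abs_of_nonneg)
  then have D: "(\<lambda>z. norm (?D z)) summable_on UNIV" by simp
  \<comment> \<open>The majorant with the order of summation reversed gives the sums over \<alpha>
    at fixed \<gamma>, that is, the coefficients of the combined series.\<close>
  have Dswap: "(\<lambda>(\<gamma>, \<alpha>). \<bar>w \<alpha>\<bar> * (\<bar>T \<alpha> \<gamma>\<bar> * wt s \<gamma>)) summable_on UNIV \<times> UNIV"
  proof -
    have "?D summable_on UNIV" using D by (rule abs_summable_summable)
    then have "?D summable_on (prod.swap ` (UNIV \<times> UNIV))" by (simp add: product_swap)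
    then show ?thesis
      by (subst (asm) summable_on_reindex) (auto simp: o_def case_prod_unfold prod.swap_def inj_on_def)
  qed
  have Dswap': "(\<lambda>z. norm (case z of (\<gamma>, \<alpha>) \<Rightarrow> \<bar>w \<alpha>\<bar> * (\<bar>T \<alpha> \<gamma>\<bar> * wt s \<gamma>))) summable_on UNIV \<times> UNIV"
    using Dswap by (rule summable_on_cong[THEN iffD1, rotated]) (auto simp: abs_mult)
  note DS = iffD1[OF Infinite_Sum.abs_summable_on_Sigma_iff Dswap']
  have S1: "(\<lambda>\<alpha>. \<bar>w \<alpha> * T \<alpha> \<gamma>\<bar>) summable_on UNIV" for \<gamma>
  proof -
    have "(\<lambda>\<alpha>. \<bar>w \<alpha>\<bar> * (\<bar>T \<alpha> \<gamma>\<bar> * wt s \<gamma>)) summable_on UNIV"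
      using DS by (auto simp: abs_mult)
    from summable_on_cmult_left[OF this, of "1 / wt s \<gamma>"]
    show ?thesis using wt_pos[of s \<gamma>] by (simp add: abs_mult)
  qed
  have S2: "(\<lambda>\<gamma>. \<Sum>\<^sub>\<infinity>\<alpha>. \<bar>w \<alpha>\<bar> * (\<bar>T \<alpha> \<gamma>\<bar> * wt s \<gamma>)) summable_on UNIV"
    using conjunct2[OF DS, THEN abs_summable_summable] by (simp add: abs_mult)
  have S3: "(\<Sum>\<^sub>\<infinity>\<alpha>. \<bar>w \<alpha>\<bar> * (\<bar>T \<alpha> \<gamma>\<bar> * wt s \<gamma>)) = (\<Sum>\<^sub>\<infinity>\<alpha>. \<bar>w \<alpha> * T \<alpha> \<gamma>\<bar>) * wt s \<gamma>" for \<gamma>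
    using S1[of \<gamma>] by (subst infsum_cmult_left[symmetric]) (auto simp: abs_mult mult_ac)
  have "\<bar>\<Sum>\<^sub>\<infinity>\<alpha>. w \<alpha> * T \<alpha> \<gamma>\<bar> \<le> (\<Sum>\<^sub>\<infinity>\<alpha>. \<bar>w \<alpha> * T \<alpha> \<gamma>\<bar>)" for \<gamma>
    using norm_infsum_bound[of "\<lambda>\<alpha>. w \<alpha> * T \<alpha> \<gamma>" UNIV] S1[of \<gamma>] by simp
  then show "conv s (\<lambda>\<gamma>. \<Sum>\<^sub>\<infinity>\<alpha>. w \<alpha> * T \<alpha> \<gamma>)"
    unfolding conv_def
    by (intro summable_on_comparison_test[OF S2]) (auto simp: S3 intro!: mult_right_mono)
  assume x: "x \<in> polybox s"
  have X: "(\<lambda>z. norm (case z of (\<alpha>, \<gamma>) \<Rightarrow> w \<alpha> * (T \<alpha> \<gamma> * monomial x \<gamma>))) summable_on UNIV"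
    by (rule summable_on_comparison_test[OF D])
      (auto simp: abs_mult intro!: mult_left_mono abs_monomial_le x)
  have P: "(\<Sum>\<^sub>\<infinity>\<gamma>. w \<alpha> * (T \<alpha> \<gamma> * monomial x \<gamma>)) = w \<alpha> * pseries (T \<alpha>) x" for \<alpha>
    unfolding pseries_def using pseries_summable[OF T1 x] by (intro infsum_cmult_right) auto
  have Q: "(\<Sum>\<^sub>\<infinity>\<alpha>. w \<alpha> * (T \<alpha> \<gamma> * monomial x \<gamma>)) = (\<Sum>\<^sub>\<infinity>\<alpha>. w \<alpha> * T \<alpha> \<gamma>) * monomial x \<gamma>" for \<gamma>
    using abs_summable_summable[of "\<lambda>\<alpha>. w \<alpha> * T \<alpha> \<gamma>" UNIV] S1[of \<gamma>]
    by (subst infsum_cmult_left[symmetric]) (auto simp: mult_ac)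
  have X': "(\<lambda>(\<alpha>, \<gamma>). w \<alpha> * (T \<alpha> \<gamma> * monomial x \<gamma>)) summable_on UNIV \<times> UNIV"
    using abs_summable_summable[OF X] by simp
  show "(\<lambda>\<alpha>. w \<alpha> * pseries (T \<alpha>) x) summable_on UNIV"
    using summable_on_Sigma_banach[OF X'] by (simp add: P)
  show "pseries (\<lambda>\<gamma>. \<Sum>\<^sub>\<infinity>\<alpha>. w \<alpha> * T \<alpha> \<gamma>) x = (\<Sum>\<^sub>\<infinity>\<alpha>. w \<alpha> * pseries (T \<alpha>) x)"
    using infsum_swap_banach[OF X'] by (simp add: P Q pseries_def[of "\<lambda>\<gamma>. \<Sum>\<^sub>\<infinity>\<alpha>. w \<alpha> * T \<alpha> \<gamma>"])
qed

lemma conv_zero [simp]: "conv s (\<lambda>_. 0)" and wnorm_zero [simp]: "wnorm s (\<lambda>_. 0) = 0"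
  and pseries_zero [simp]: "pseries (\<lambda>_. 0) x = 0"
  by (simp_all add: conv_def wnorm_def pseries_def)

lemma conv_cmult:
  assumes "conv s g"
  shows "conv s (\<lambda>\<alpha>. c * g \<alpha>)"
  using summable_on_cmult_right[OF assms[unfolded conv_def], of "\<bar>c\<bar>"]
  by (simp add: conv_def abs_mult mult.assoc)

lemma pseries_cmult:
  "conv s g \<Longrightarrow> x \<in> polybox s \<Longrightarrow> pseries (\<lambda>\<alpha>. c * g \<alpha>) x = c * pseries g x"
  unfolding pseries_def
  by (subst infsum_cmult_right[symmetric]) (auto simp: mult.assoc intro: pseries_summable)

text \<open>\<open>T \<alpha>\<close> is the tail of a divisor $x^\alpha + T_\alpha$ with leading exponent \<open>\<alpha>\<close>.\<close>

lemma pseries_division: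
  assumes T0: "\<And>\<alpha> \<gamma>. \<alpha> \<in> E \<Longrightarrow> T \<alpha> \<gamma> \<noteq> 0 \<Longrightarrow> godel \<alpha> < godel \<gamma>"
    and T1: "\<And>\<alpha>. \<alpha> \<in> E \<Longrightarrow> conv s (T \<alpha>)"
    and T2: "\<And>\<alpha>. \<alpha> \<in> E \<Longrightarrow> wnorm s (T \<alpha>) \<le> wt s \<alpha> / 2"
    and bound: "\<And>\<alpha> x. \<alpha> \<in> E \<Longrightarrow> x \<in> polybox s \<Longrightarrow>
      \<bar>monomial x \<alpha> + pseries (T \<alpha>) x\<bar> \<le> wt s \<alpha> * v x"
    and v: "\<And>x. v x \<ge> 0"
    and h: "conv s h"
  shows "\<exists>R. conv s R \<and> (\<forall>\<alpha>\<in>E. R \<alpha> = 0) \<and>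
    (\<forall>x\<in>polybox s. \<bar>pseries h x - pseries R x\<bar> \<le> 2 * wnorm s h * v x)"
proof -
  define w where "w = quot E T h"
  \<comment> \<open>Extending by zero outside \<open>E\<close>, where \<open>w\<close> vanishes too,
    makes the bounds hold for every exponent.\<close>
  define T' where "T' \<alpha> = (if \<alpha> \<in> E then T \<alpha> else (\<lambda>_. 0))" for \<alpha>
  define S where "S \<gamma> = (\<Sum>\<^sub>\<infinity>\<alpha>. w \<alpha> * T' \<alpha> \<gamma>)" for \<gamma>
  define R where "R \<gamma> = h \<gamma> + (-1) * (w \<gamma> + S \<gamma>)" for \<gamma>
  have w: "conv s w" "wnorm s w \<le> 2 * wnorm s h"
    unfolding w_def by (rule quot_conv; fact)+
  have T'1: "conv s (T' \<alpha>)" and T'2: "wnorm s (T' \<alpha>) \<le> 1/2 * wt s \<alpha>" for \<alpha>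
    using T1 T2 by (auto simp: T'_def)
  note swap = pseries_infsum_swap[OF w(1) T'1 T'2]
  have S: "conv s S" unfolding S_def by (rule swap(1))
  have "conv s R" unfolding R_def by (intro conv_add conv_cmult h w S)
  moreover have "R \<gamma> = 0" if "\<gamma> \<in> E" for \<gamma>
  proof -
    \<comment> \<open>By \<open>T0\<close> only the terms occurring in the recursion for
      \<open>quot\<close> survive, and that recursion says
      \<open>S \<gamma> = h \<gamma> - w \<gamma>\<close>.\<close>
    have "S \<gamma> = (\<Sum>\<^sub>\<infinity>\<alpha>\<in>{\<beta>\<in>E. godel \<beta> < godel \<gamma>}. w \<alpha> * T \<alpha> \<gamma>)"
      unfolding S_def using T0 by (intro infsum_cong_neutral) (auto simp: T'_def)
    also have "\<dots> = (\<Sum>\<alpha>\<in>{\<beta>\<in>E. godel \<beta> < godel \<gamma>}. w \<alpha> * T \<alpha> \<gamma>)"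
      by (intro infsum_finite finite_subset[OF _ finite_godel_less[of "godel \<gamma>"]]) auto
    finally show ?thesis
      using that quot.simps[of E T h \<gamma>] by (simp add: R_def w_def)
  qed
  moreover have "\<bar>pseries h x - pseries R x\<bar> \<le> 2 * wnorm s h * v x" if x: "x \<in> polybox s" for x
  proof -
    let ?p = "\<lambda>\<alpha>. w \<alpha> * (monomial x \<alpha> + pseries (T' \<alpha>) x)"
    have "pseries R x = pseries h x - (pseries w x + pseries S x)"
      unfolding R_def
      by (subst pseries_add[OF h conv_cmult x]; (subst pseries_cmult)?; (subst pseries_add)?)
        (auto intro: conv_add w S x)
    also have "pseries w x + pseries S x = (\<Sum>\<^sub>\<infinity>\<alpha>. ?p \<alpha>)"
      unfolding S_def swap(3)[OF x] unfolding pseries_def[of w]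
      by (subst infsum_add[symmetric]) (auto simp: distrib_left pseries_summable[OF w(1) x] swap(2)[OF x])
    finally have diff: "pseries h x - pseries R x = (\<Sum>\<^sub>\<infinity>\<alpha>. ?p \<alpha>)" by simp
    \<comment> \<open>The bracket in \<open>?p\<close> is the value of a divisor; after summation
      the bound becomes \<open>v x\<close> times the norm of the quotients.\<close>
    have le: "\<bar>?p \<alpha>\<bar> \<le> v x * (\<bar>w \<alpha>\<bar> * wt s \<alpha>)" for \<alpha>
    proof (cases "\<alpha> \<in> E")
      case True
      then show ?thesis
        using mult_left_mono[OF bound[OF True x], of "\<bar>w \<alpha>\<bar>"] by (simp add: T'_def abs_mult mult_ac)
    qed (simp add: w_def quot_notin v)
    have summ: "(\<lambda>\<alpha>. v x * (\<bar>w \<alpha>\<bar> * wt s \<alpha>)) summable_on UNIV"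
      using w(1) unfolding conv_def by (rule summable_on_cmult_right)
    have abs: "(\<lambda>\<alpha>. norm (?p \<alpha>)) summable_on UNIV"
      by (rule summable_on_comparison_test[OF summ]) (use le in auto)
    have "\<bar>\<Sum>\<^sub>\<infinity>\<alpha>. ?p \<alpha>\<bar> \<le> (\<Sum>\<^sub>\<infinity>\<alpha>. \<bar>?p \<alpha>\<bar>)"
      using norm_infsum_bound[OF abs] by simp
    also have "\<dots> \<le> (\<Sum>\<^sub>\<infinity>\<alpha>. v x * (\<bar>w \<alpha>\<bar> * wt s \<alpha>))"
      using abs by (intro infsum_mono summ le) simp
    also have "\<dots> = v x * wnorm s w"
      unfolding wnorm_def using w(1) by (intro infsum_cmult_right) (simp add: conv_def)
    also have "\<dots> \<le> v x * (2 * wnorm s h)"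
      by (intro mult_left_mono w v)
    finally show ?thesis by (simp add: diff mult_ac)
  qed
  ultimately show ?thesis by blast
qed

section \<open>Monotone subsequences and Dickson's lemma\<close>

lemma nat_incseq_subseq:
  fixes u :: "nat \<Rightarrow> nat"
  obtains \<phi> where "strict_mono \<phi>" "incseq (\<lambda>n. u (\<phi> n))"
proof -
  obtain \<phi> where \<phi>: "strict_mono \<phi>" "monoseq (\<lambda>n. u (\<phi> n))"
    using seq_monosub by blast
  show ?thesis
  proof (cases "incseq (\<lambda>n. u (\<phi> n))")
    case False
    then have dec: "decseq (\<lambda>n. u (\<phi> n))" using \<phi>(2) by (simp add: monoseq_iff)
    \<comment> \<open>A decreasing sequence of natural numbers is constant from the index of its
      minimum on, and is then also increasing.\<close>
    obtain N where N: "\<And>n. u (\<phi> N) \<le> u (\<phi> n)"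
      using ex_has_least_nat[of "\<lambda>_. True" 0 "\<lambda>n. u (\<phi> n)"] by auto
    have "u (\<phi> (N + n)) = u (\<phi> N)" for n
      using N decseqD[OF dec, of N "N + n"] by (simp add: antisym)
    then have "incseq (\<lambda>n. u (\<phi> (N + n)))" by (simp add: incseq_def)
    moreover have "strict_mono (\<lambda>n. \<phi> (N + n))" using \<phi>(1) by (simp add: strict_mono_def)
    ultimately show ?thesis using that[of "\<lambda>n. \<phi> (N + n)"] by blast
  qed (use \<phi> that in blast)
qed

text \<open>Thinning out one coordinate at a time: monotonicity already achieved survives passage to
  a further subsequence.\<close>

lemma incseq_subseq_coordinates:
  fixes q :: "nat \<Rightarrow> 'n \<Rightarrow> nat"
  assumes "finite S"
  shows "\<exists>\<phi>. strict_mono \<phi> \<and> (\<forall>i\<in>S. incseq (\<lambda>n. q (\<phi> n) i))"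
  using assms
proof induction
  case empty
  show ?case by (rule exI[of _ id]) (simp add: strict_mono_def)
next
  case (insert i S)
  then obtain \<phi> where \<phi>: "strict_mono \<phi>" "\<forall>i\<in>S. incseq (\<lambda>n. q (\<phi> n) i)" by blast
  obtain \<psi> where \<psi>: "strict_mono \<psi>" "incseq (\<lambda>n. q (\<phi> (\<psi> n)) i)"
    using nat_incseq_subseq[of "\<lambda>n. q (\<phi> n) i"] by blast
  have "strict_mono (\<lambda>n. \<phi> (\<psi> n))" using \<phi>(1) \<psi>(1) by (simp add: strict_mono_def)
  moreover have "incseq (\<lambda>n. q (\<phi> (\<psi> n)) j)" if "j \<in> S" for j
    using \<phi>(2) that strict_mono_mono[OF \<psi>(1)] by (simp add: incseq_def mono_def)
  ultimately show ?case using \<psi>(2) by (intro exI[of _ "\<lambda>n. \<phi> (\<psi> n)"]) auto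
qed

text \<open>\<open>F\<close> consists of the minimal elements of \<open>E\<close>. Infinitely many
  of them would contain a coordinatewise increasing sequence, hence two distinct comparable ones.
  That every element lies above a minimal one follows by induction on the total degree.\<close>

lemma dickson:
  fixes E :: "('n::finite \<Rightarrow> nat) set"
  obtains F where "finite F" "F \<subseteq> E" "\<And>\<alpha>. \<alpha> \<in> E \<Longrightarrow> \<exists>e\<in>F. e \<le> \<alpha>"
proof
  define F where "F = {e\<in>E. \<forall>\<beta>\<in>E. \<beta> \<le> e \<longrightarrow> \<beta> = e}"
  show "F \<subseteq> E" by (auto simp: F_def)
  show "finite F"
  proof (rule ccontr)
    assume "infinite F"
    then obtain q :: "nat \<Rightarrow> 'n \<Rightarrow> nat" where q: "inj q" "range q \<subseteq> F"
      using infinite_countable_subset by blast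
    obtain \<phi> where \<phi>: "strict_mono \<phi>" "\<forall>i\<in>UNIV. incseq (\<lambda>n. q (\<phi> n) i)"
      using incseq_subseq_coordinates[OF finite, of UNIV q] by blast
    then have "q (\<phi> 0) \<le> q (\<phi> 1)" by (simp add: le_fun_def incseq_def)
    moreover have "q (\<phi> 0) \<in> E" "q (\<phi> 1) \<in> F" using q(2) by (auto simp: F_def)
    ultimately have "q (\<phi> 0) = q (\<phi> 1)" unfolding F_def by blast
    then have "\<phi> 0 = \<phi> 1" using q(1) by (simp add: inj_eq)
    with \<phi>(1) show False by (simp add: strict_mono_eq)
  qed
  fix \<alpha> assume "\<alpha> \<in> E"
  then show "\<exists>e\<in>F. e \<le> \<alpha>"
  proof (induction "\<Sum>i\<in>UNIV. \<alpha> i" arbitrary: \<alpha> rule: less_induct)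
    case less
    show ?case
    proof (cases "\<alpha> \<in> F")
      case False
      then obtain \<beta> where \<beta>: "\<beta> \<in> E" "\<beta> \<le> \<alpha>" "\<beta> \<noteq> \<alpha>" using less.prems by (auto simp: F_def)
      then obtain i where "\<beta> i < \<alpha> i" by (metis ext le_funD le_neq_implies_less)
      then have "(\<Sum>i\<in>UNIV. \<beta> i) < (\<Sum>i\<in>UNIV. \<alpha> i)"
        using \<beta>(2) by (intro sum_strict_mono_ex1) (auto simp: le_fun_def)
      from less.hyps[OF this \<beta>(1)] \<beta>(2) show ?thesis by (blast intro: order_trans)
    qed blast
  qed
qed

section \<open>Multiplication of a series by a monomial\<close>

definition shift :: "('n \<Rightarrow> nat) \<Rightarrow> (('n \<Rightarrow> nat) \<Rightarrow> real) \<Rightarrow> ('n \<Rightarrow> nat) \<Rightarrow> real" where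
  "shift \<delta> g \<gamma> = (if \<delta> \<le> \<gamma> then g (\<lambda>i. \<gamma> i - \<delta> i) else 0)"

text \<open>The factor \<open>u\<close> is arbitrary so that the reindexing serves both the weights
  in \<open>shift_conv\<close> and the monomials in \<open>pseries_shift\<close>.\<close>

lemma has_sum_shift:
  assumes "((\<lambda>\<beta>. g \<beta> * u (\<lambda>i. \<delta> i + \<beta> i)) has_sum a) UNIV"
  shows "((\<lambda>\<gamma>. shift \<delta> g \<gamma> * u \<gamma>) has_sum a) UNIV"
proof -
  let ?j = "\<lambda>\<beta> i. \<delta> i + \<beta> i :: nat"
  have inj: "inj ?j" by (auto simp: inj_def fun_eq_iff)
  have "((\<lambda>\<gamma>. shift \<delta> g \<gamma> * u \<gamma>) has_sum a) (range ?j)"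
    using assms by (subst has_sum_reindex[OF inj]) (simp add: o_def shift_def le_fun_def)
  moreover have "shift \<delta> g \<gamma> = 0" if "\<gamma> \<notin> range ?j" for \<gamma>
  proof -
    have "\<gamma> \<in> range ?j" if "\<delta> \<le> \<gamma>"
      using that by (intro image_eqI[of _ _ "\<lambda>i. \<gamma> i - \<delta> i"]) (simp_all add: fun_eq_iff le_fun_def)
    with that have "\<not> \<delta> \<le> \<gamma>" by blast
    then show ?thesis by (simp add: shift_def)
  qed
  ultimately show ?thesis
    by (subst has_sum_cong_neutral[of "range ?j" UNIV]) auto
qed

lemma shift_conv:
  fixes \<delta> :: "'n::finite \<Rightarrow> nat"
  assumes "conv s g"
  shows "conv s (shift \<delta> g)" "wnorm s (shift \<delta> g) = wt s \<delta> * wnorm s g"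
proof -
  have "((\<lambda>\<beta>. wt s \<delta> * (\<bar>g \<beta>\<bar> * wt s \<beta>)) has_sum wt s \<delta> * wnorm s g) UNIV"
    using assms unfolding conv_def wnorm_def by (intro has_sum_cmult_right has_sum_infsum)
  then have "((\<lambda>\<gamma>. shift \<delta> (\<lambda>\<beta>. \<bar>g \<beta>\<bar>) \<gamma> * wt s \<gamma>) has_sum wt s \<delta> * wnorm s g) UNIV"
    by (intro has_sum_shift) (simp add: wt_add mult_ac)
  moreover have "shift \<delta> (\<lambda>\<beta>. \<bar>g \<beta>\<bar>) \<gamma> = \<bar>shift \<delta> g \<gamma>\<bar>" for \<gamma>
    by (simp add: shift_def)
  ultimately have "((\<lambda>\<gamma>. \<bar>shift \<delta> g \<gamma>\<bar> * wt s \<gamma>) has_sum wt s \<delta> * wnorm s g) UNIV" by simp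
  then show "conv s (shift \<delta> g)" "wnorm s (shift \<delta> g) = wt s \<delta> * wnorm s g"
    by (auto simp: conv_def wnorm_def summable_on_def infsumI)
qed

lemma pseries_shift:
  assumes "conv s g" "x \<in> polybox s"
  shows "pseries (shift \<delta> g) x = monomial x \<delta> * pseries g x"
proof -
  have "((\<lambda>\<beta>. monomial x \<delta> * (g \<beta> * monomial x \<beta>)) has_sum monomial x \<delta> * pseries g x) UNIV"
    unfolding pseries_def by (intro has_sum_cmult_right has_sum_infsum pseries_summable[OF assms])
  then have "((\<lambda>\<gamma>. shift \<delta> g \<gamma> * monomial x \<gamma>) has_sum monomial x \<delta> * pseries g x) UNIV"
    by (intro has_sum_shift) (simp add: monomial_add mult_ac)
  then show ?thesis unfolding pseries_def by (rule infsumI)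
qed

section \<open>Uniform domination\<close>

text \<open>As usual for local orders on power series, the leading term is the lowest one; its
  coefficient is normalized to 1.\<close>

definition leads :: "(('n::finite \<Rightarrow> nat) \<Rightarrow> real) \<Rightarrow> ('n \<Rightarrow> nat) \<Rightarrow> bool" where
  "leads g e \<longleftrightarrow> g e = 1 \<and> (\<forall>\<gamma>. g \<gamma> \<noteq> 0 \<longrightarrow> \<gamma> \<noteq> e \<longrightarrow> godel e < godel \<gamma>)"

lemma leads_exists:
  fixes g :: "('n::finite \<Rightarrow> nat) \<Rightarrow> real"
  assumes "g \<alpha> \<noteq> 0"
  obtains e where "g e \<noteq> 0" "leads (\<lambda>\<gamma>. (1 / g e) * g \<gamma>) e"
proof -
  obtain e where e: "g e \<noteq> 0" "\<And>\<gamma>. g \<gamma> \<noteq> 0 \<Longrightarrow> godel e \<le> godel \<gamma>"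
    using ex_has_least_nat[of "\<lambda>\<gamma>. g \<gamma> \<noteq> 0" \<alpha> godel] assms by blast
  then have "godel e < godel \<gamma>" if "g \<gamma> \<noteq> 0" "\<gamma> \<noteq> e" for \<gamma>
    using that inj_godel[where 'n = 'n] by (metis injD le_neq_implies_less)
  with e(1) show ?thesis by (intro that[of e]) (auto simp: leads_def)
qed

lemma conv_fun_upd:
  assumes "conv s g"
  shows "conv s (g(e := 0))"
  unfolding conv_def
  by (rule summable_on_comparison_test[OF assms[unfolded conv_def]]) auto

lemma pseries_leads:
  assumes "conv s g" "g e = 1" "x \<in> polybox s"
  shows "pseries g x = monomial x e + pseries (g(e := 0)) x"
proof -
  have "pseries g x = (\<Sum>\<^sub>\<infinity>\<alpha>\<in>{e} \<union> (- {e}). g \<alpha> * monomial x \<alpha>)"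
    by (simp add: pseries_def Compl_partition)
  also have "\<dots> = monomial x e + (\<Sum>\<^sub>\<infinity>\<alpha>\<in>- {e}. g \<alpha> * monomial x \<alpha>)"
    using assms(2) summable_on_subset_banach[OF pseries_summable[OF assms(1,3)], of "- {e}"]
    by (subst infsum_Un_disjoint) auto
  also have "(\<Sum>\<^sub>\<infinity>\<alpha>\<in>- {e}. g \<alpha> * monomial x \<alpha>) = pseries (g(e := 0)) x"
    unfolding pseries_def by (rule infsum_cong_neutral) auto
  finally show ?thesis .
qed

text \<open>With G = \<open>godel e\<close>, integrality forces every tail exponent to have
  \<open>godel\<close> at least G + 1. Raising s by m therefore shrinks the tail by at least the
  factor (G + 1)^m but the leading weight only by G^m, and the quotient (G/(G + 1))^m tends to
  0.\<close>

lemma leading_term_dominates: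
  assumes "conv s0 g" "leads g e"
  obtains s1 where "s0 \<le> s1" "\<And>s. s1 \<le> s \<Longrightarrow> wnorm s (g(e := 0)) \<le> wt s e / 2"
proof -
  let ?G = "real (godel e)" and ?t = "g(e := 0)"
  have G: "?G > 0" by (simp add: godel_pos)
  have t: "conv s0 ?t" by (rule conv_fun_upd[OF assms(1)])
  have "(\<lambda>m. wnorm s0 ?t * ?G ^ s0 * (?G / (?G + 1)) ^ m) \<longlonglongrightarrow> wnorm s0 ?t * ?G ^ s0 * 0"
    using G by (intro tendsto_mult_left LIMSEQ_power_zero) simp
  then have "\<forall>\<^sub>F m in sequentially. wnorm s0 ?t * ?G ^ s0 * (?G / (?G + 1)) ^ m < 1/2"
    by (intro order_tendstoD(2)) auto
  then obtain M where M: "\<And>m. m \<ge> M \<Longrightarrow> wnorm s0 ?t * ?G ^ s0 * (?G / (?G + 1)) ^ m < 1/2"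
    by (auto simp: eventually_sequentially)
  show ?thesis
  proof (rule that[of "s0 + M"])
    fix s assume s: "s0 + M \<le> s"
    define m where "m = s - s0"
    have m: "s = s0 + m" "M \<le> m" using s by (auto simp: m_def)
    have le: "\<bar>?t \<gamma>\<bar> * wt s \<gamma> \<le> (\<bar>?t \<gamma>\<bar> * wt s0 \<gamma>) * (1 / (?G + 1) ^ m)" for \<gamma>
    proof (cases "?t \<gamma> = 0")
      case False
      then have "godel e < godel \<gamma>" using assms(2) by (auto simp: leads_def split: if_splits)
      then have le: "(?G + 1) ^ m \<le> real (godel \<gamma>) ^ m" by (intro power_mono) auto
      have "wt s \<gamma> = wt s0 \<gamma> * (1 / real (godel \<gamma>) ^ m)"
        by (simp add: wt_def m(1) power_add)
      also have "\<dots> \<le> wt s0 \<gamma> * (1 / (?G + 1) ^ m)"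
        using G godel_pos[of \<gamma>] le by (intro mult_left_mono divide_left_mono) auto
      finally show ?thesis by (metis abs_ge_zero mult.assoc mult_left_mono)
    qed simp
    have "wnorm s ?t \<le> (\<Sum>\<^sub>\<infinity>\<gamma>. (\<bar>?t \<gamma>\<bar> * wt s0 \<gamma>) * (1 / (?G + 1) ^ m))"
      unfolding wnorm_def
      using conv_mono[OF t, of s] t m(1) unfolding conv_def
      by (intro infsum_mono le summable_on_cmult_left) auto
    also have "\<dots> = wnorm s0 ?t * (1 / (?G + 1) ^ m)"
      unfolding wnorm_def using t unfolding conv_def by (intro infsum_cmult_left) auto
    also have "\<dots> = wnorm s0 ?t * ?G ^ s0 * (?G / (?G + 1)) ^ m * wt s e"
      using G by (simp add: wt_def m(1) power_add power_divide)
    also have "\<dots> \<le> 1/2 * wt s e"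
      using M[OF m(2)] by (intro mult_right_mono) auto
    finally show "wnorm s ?t \<le> wt s e / 2" by simp
  qed simp
qed

text \<open>Membership in the ideal used for the standard basis. Since \<open>s\<close>,
  \<open>K\<close> and \<open>C\<close> may depend on \<open>g\<close>, every coefficient series a_j
  with j at least 1 will belong to it trivially.\<close>

definition dominated :: "(nat \<Rightarrow> real ^ 'n \<Rightarrow> real) \<Rightarrow> (('n::finite \<Rightarrow> nat) \<Rightarrow> real) \<Rightarrow> bool" where
  "dominated V g \<longleftrightarrow> (\<exists>s K C. conv s g \<and> (\<forall>x\<in>polybox s. \<bar>pseries g x\<bar> \<le> C * V K x))"

text \<open>The gain is that \<open>s\<close>, \<open>K\<close> and \<open>C\<close> no longer
  depend on \<open>h\<close>. Finitely many dominated series have leading exponents generating all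
  those of the ideal; division by their monomial multiples transfers their common bound to each
  dominated \<open>h\<close>, at the cost of its norm.\<close>

lemma dominated_uniform:
  fixes V :: "nat \<Rightarrow> real ^ 'n::finite \<Rightarrow> real"
  assumes V0: "\<And>K x. V K x \<ge> 0" and Vinc: "\<And>x. incseq (\<lambda>K. V K x)"
  obtains s K C where "s0 \<le> s" "C \<ge> 0"
    "\<And>h x. dominated V h \<Longrightarrow> conv s h \<Longrightarrow> x \<in> polybox s \<Longrightarrow> \<bar>pseries h x\<bar> \<le> C * wnorm s h * V K x"
proof -
  have Vmono: "V K x \<le> V K' x" if "K \<le> K'" for K K' x
    using incseqD[OF Vinc that] .
  define E where "E = {e. \<exists>g. dominated V g \<and> leads g e}"
  obtain F where F: "finite F" "F \<subseteq> E" "\<And>\<alpha>. \<alpha> \<in> E \<Longrightarrow> \<exists>e\<in>F. e \<le> \<alpha>"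
    using dickson[of E] by blast
  have "\<forall>e\<in>F. \<exists>g. dominated V g \<and> leads g e" using F(2) by (auto simp: E_def)
  then obtain g where g: "\<And>e. e \<in> F \<Longrightarrow> dominated V (g e)" "\<And>e. e \<in> F \<Longrightarrow> leads (g e) e"
    by metis
  have "\<forall>e\<in>F. \<exists>s1 K C. conv s1 (g e) \<and> (\<forall>x\<in>polybox s1. \<bar>pseries (g e) x\<bar> \<le> C * V K x) \<and>
      (\<forall>s\<ge>s1. wnorm s ((g e)(e := 0)) \<le> wt s e / 2)"
  proof
    fix e assume e: "e \<in> F"
    obtain s K C where s: "conv s (g e)" "\<forall>x\<in>polybox s. \<bar>pseries (g e) x\<bar> \<le> C * V K x"
      using g(1)[OF e] unfolding dominated_def by blast
    obtain s1 where s1: "s \<le> s1" "\<And>s. s1 \<le> s \<Longrightarrow> wnorm s ((g e)(e := 0)) \<le> wt s e / 2"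
      using leading_term_dominates[OF s(1) g(2)[OF e]] by blast
    show "\<exists>s1 K C. conv s1 (g e) \<and> (\<forall>x\<in>polybox s1. \<bar>pseries (g e) x\<bar> \<le> C * V K x) \<and>
      (\<forall>s\<ge>s1. wnorm s ((g e)(e := 0)) \<le> wt s e / 2)"
      using s s1 polybox_mono[OF s1(1)] conv_mono[OF s(1) s1(1)] by blast
  qed
  then obtain s1 K1 C1 where g1: "\<And>e. e \<in> F \<Longrightarrow> conv (s1 e) (g e)"
      "\<And>e x. e \<in> F \<Longrightarrow> x \<in> polybox (s1 e) \<Longrightarrow> \<bar>pseries (g e) x\<bar> \<le> C1 e * V (K1 e) x"
      "\<And>e s. e \<in> F \<Longrightarrow> s1 e \<le> s \<Longrightarrow> wnorm s ((g e)(e := 0)) \<le> wt s e / 2"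
    by metis
  \<comment> \<open>Sums over \<open>F\<close> are convenient common upper bounds for the finitely
    many parameters.\<close>
  define s where "s = s0 + sum s1 F"
  define K where "K = sum K1 F"
  \<comment> \<open>Dividing by \<open>wt s e\<close> brings the bound for \<open>g e\<close> into
    the form \<open>wt s e * (C * V K x)\<close>, which is stable under multiplication by
    monomials.\<close>
  define C where "C = (\<Sum>e\<in>F. \<bar>C1 e\<bar> / wt s e)"
  have le_s: "s1 e \<le> s" and le_K: "K1 e \<le> K" and le_C: "\<bar>C1 e\<bar> / wt s e \<le> C" if "e \<in> F" for e
    using member_le_sum[OF that _ F(1), of s1] member_le_sum[OF that _ F(1), of K1]
      member_le_sum[OF that _ F(1), of "\<lambda>e. \<bar>C1 e\<bar> / wt s e"]
    by (auto simp: s_def K_def C_def)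
  have C: "C \<ge> 0" unfolding C_def by (intro sum_nonneg) simp
  have gconv: "conv s (g e)" if "e \<in> F" for e
    using conv_mono[OF g1(1) le_s] that by blast
  have gbound: "\<bar>pseries (g e) x\<bar> \<le> wt s e * (C * V K x)" if "e \<in> F" "x \<in> polybox s" for e x
  proof -
    have "\<bar>pseries (g e) x\<bar> \<le> C1 e * V (K1 e) x"
      using g1(2) polybox_mono[OF le_s] that by blast
    also have "\<dots> \<le> \<bar>C1 e\<bar> * V K x"
      by (intro mult_mono Vmono le_K that V0) auto
    also have "\<dots> \<le> (wt s e * C) * V K x"
      using le_C[OF that(1)] wt_pos[of s e] by (intro mult_right_mono V0) (simp add: divide_le_eq mult_ac)
    finally show ?thesis by (simp add: mult_ac)
  qed
  define pick where "pick \<alpha> = (SOME e. e \<in> F \<and> e \<le> \<alpha>)" for \<alpha>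
  have pick: "pick \<alpha> \<in> F" "pick \<alpha> \<le> \<alpha>" if "\<alpha> \<in> E" for \<alpha>
    using someI_ex[of "\<lambda>e. e \<in> F \<and> e \<le> \<alpha>"] F(3)[OF that] by (auto simp: pick_def)
  define \<delta> where "\<delta> \<alpha> = (\<lambda>i. \<alpha> i - pick \<alpha> i)" for \<alpha>
  have split: "\<alpha> = (\<lambda>i. \<delta> \<alpha> i + pick \<alpha> i)" if "\<alpha> \<in> E" for \<alpha>
    using pick(2)[OF that] by (simp add: \<delta>_def le_fun_def)
  \<comment> \<open>The divisor with leading exponent \<alpha> is the multiple of
    \<open>g (pick \<alpha>)\<close> by the monomial with exponent \<open>\<delta> \<alpha>\<close>;
    this is its tail.\<close>
  define T where "T \<alpha> = shift (\<delta> \<alpha>) ((g (pick \<alpha>))(pick \<alpha> := 0))" for \<alpha>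
  have T0: "godel \<alpha> < godel \<gamma>" if "\<alpha> \<in> E" "T \<alpha> \<gamma> \<noteq> 0" for \<alpha> \<gamma>
  proof -
    define \<beta> where "\<beta> = (\<lambda>i. \<gamma> i - \<delta> \<alpha> i)"
    have le: "\<delta> \<alpha> \<le> \<gamma>" and \<beta>: "g (pick \<alpha>) \<beta> \<noteq> 0" "\<beta> \<noteq> pick \<alpha>"
      using that(2) by (auto simp: T_def shift_def \<beta>_def split: if_splits)
    then have "godel (pick \<alpha>) < godel \<beta>"
      using g(2)[OF pick(1)[OF that(1)]] by (auto simp: leads_def)
    moreover have "godel \<alpha> = godel (\<delta> \<alpha>) * godel (pick \<alpha>)"
      using split[OF that(1)] godel_add[of "\<delta> \<alpha>" "pick \<alpha>"] by simp
    moreover have "godel \<gamma> = godel (\<delta> \<alpha>) * godel \<beta>"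
    proof -
      have "\<gamma> = (\<lambda>i. \<delta> \<alpha> i + \<beta> i)" using le by (simp add: \<beta>_def le_fun_def)
      then show ?thesis using godel_add[of "\<delta> \<alpha>" \<beta>] by simp
    qed
    ultimately show ?thesis by (simp add: godel_pos)
  qed
  have T1: "conv s (T \<alpha>)" if "\<alpha> \<in> E" for \<alpha>
    unfolding T_def by (intro shift_conv conv_fun_upd gconv pick that)
  have wt_split: "wt s \<alpha> = wt s (\<delta> \<alpha>) * wt s (pick \<alpha>)" if "\<alpha> \<in> E" for \<alpha>
    using split[OF that] wt_add[of s "\<delta> \<alpha>" "pick \<alpha>"] by simp
  have T2: "wnorm s (T \<alpha>) \<le> wt s \<alpha> / 2" if "\<alpha> \<in> E" for \<alpha>
  proof -
    have "wnorm s (T \<alpha>) = wt s (\<delta> \<alpha>) * wnorm s ((g (pick \<alpha>))(pick \<alpha> := 0))"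
      unfolding T_def by (intro shift_conv conv_fun_upd gconv pick that)
    also have "\<dots> \<le> wt s (\<delta> \<alpha>) * (wt s (pick \<alpha>) / 2)"
      by (intro mult_left_mono g1(3) pick that le_s) simp
    finally show ?thesis by (simp add: wt_split[OF that])
  qed
  have bound: "\<bar>monomial x \<alpha> + pseries (T \<alpha>) x\<bar> \<le> wt s \<alpha> * (C * V K x)"
    if "\<alpha> \<in> E" and x: "x \<in> polybox s" for \<alpha> x
  proof -
    let ?e = "pick \<alpha>"
    have e: "?e \<in> F" by (rule pick(1)[OF that(1)])
    have "monomial x \<alpha> = monomial x (\<delta> \<alpha>) * monomial x ?e"
      using split[OF that(1)] monomial_add[of x "\<delta> \<alpha>" ?e] by simp
    then have "monomial x \<alpha> + pseries (T \<alpha>) x = monomial x (\<delta> \<alpha>) * pseries (g ?e) x"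
      using pseries_leads[OF gconv[OF e] _ x, of ?e] g(2)[OF e]
        pseries_shift[OF conv_fun_upd[OF gconv[OF e]] x]
      by (simp add: T_def leads_def distrib_left)
    also have "\<bar>\<dots>\<bar> \<le> wt s (\<delta> \<alpha>) * (wt s ?e * (C * V K x))"
      unfolding abs_mult by (intro mult_mono abs_monomial_le gbound x e) auto
    finally show ?thesis by (simp add: wt_split[OF that(1)] mult.assoc)
  qed
  show ?thesis
  proof (rule that[of s "2 * C" K])
    fix h and x :: "real ^ 'n"
    assume h: "dominated V h" "conv s h" and x: "x \<in> polybox s"
    have nonneg: "C * V K x \<ge> 0" for x by (simp add: C V0)
    have "\<exists>R. conv s R \<and> (\<forall>\<alpha>\<in>E. R \<alpha> = 0) \<and>
        (\<forall>x\<in>polybox s. \<bar>pseries h x - pseries R x\<bar> \<le> 2 * wnorm s h * (C * V K x))"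
      by (rule pseries_division[of E T s "\<lambda>x. C * V K x" h, OF T0 T1 T2 bound nonneg h(2)])
    then obtain R where R: "conv s R" "\<And>\<alpha>. \<alpha> \<in> E \<Longrightarrow> R \<alpha> = 0"
      "\<And>x. x \<in> polybox s \<Longrightarrow> \<bar>pseries h x - pseries R x\<bar> \<le> 2 * wnorm s h * (C * V K x)"
      by blast
    \<comment> \<open>From |R| \<le> |h| + |h - R| the remainder is itself dominated. If it were
      nonzero, its leading exponent would lie in \<open>E\<close>, where \<open>R\<close> vanishes.
      The parameters private to \<open>h\<close> enter this qualitative argument but not the final
      constants.\<close>
    have "R = (\<lambda>_. 0)"
    proof (rule ccontr)
      assume "R \<noteq> (\<lambda>_. 0)"
      then obtain \<alpha> where "R \<alpha> \<noteq> 0" by blast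
      then obtain e where e: "R e \<noteq> 0" "leads (\<lambda>\<gamma>. (1 / R e) * R \<gamma>) e"
        by (rule leads_exists)
      obtain s' K' C' where s': "conv s' h" "\<forall>x\<in>polybox s'. \<bar>pseries h x\<bar> \<le> C' * V K' x"
        using h(1) unfolding dominated_def by blast
      let ?c = "\<bar>1 / R e\<bar>" and ?s = "max s s'" and ?K = "max K K'"
      have "\<bar>pseries (\<lambda>\<gamma>. (1 / R e) * R \<gamma>) y\<bar> \<le> (?c * (\<bar>C'\<bar> + 2 * wnorm s h * C)) * V ?K y"
        if "y \<in> polybox ?s" for y
      proof -
        have y: "y \<in> polybox s" "y \<in> polybox s'"
          using that polybox_mono[of s ?s] polybox_mono[of s' ?s] by auto
        have "\<bar>pseries R y\<bar> \<le> \<bar>pseries h y\<bar> + \<bar>pseries h y - pseries R y\<bar>" by linarith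
        also have "\<dots> \<le> C' * V K' y + 2 * wnorm s h * (C * V K y)"
          using s'(2) y R(3) by (intro add_mono) auto
        also have "\<dots> \<le> \<bar>C'\<bar> * V ?K y + 2 * wnorm s h * (C * V ?K y)"
          by (intro add_mono mult_mono Vmono V0 mult_nonneg_nonneg C wnorm_nonneg) (auto simp: wnorm_nonneg)
        finally have "?c * \<bar>pseries R y\<bar> \<le> ?c * ((\<bar>C'\<bar> + 2 * wnorm s h * C) * V ?K y)"
          by (intro mult_left_mono) (auto simp: algebra_simps)
        then show ?thesis unfolding pseries_cmult[OF R(1) y(1)] abs_mult mult.assoc .
      qed
      moreover have "conv ?s (\<lambda>\<gamma>. (1 / R e) * R \<gamma>)"
        by (rule conv_mono[OF conv_cmult[OF R(1)]]) simp
      ultimately have "dominated V (\<lambda>\<gamma>. (1 / R e) * R \<gamma>)"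
        unfolding dominated_def by blast
      with e show False using R(2)[of e] by (auto simp: E_def)
    qed
    then show "\<bar>pseries h x\<bar> \<le> 2 * C * wnorm s h * V K x"
      using R(3)[OF x] by (simp add: mult_ac)
  qed (use C in \<open>auto simp: s_def\<close>)
qed

section \<open>Zeros of one-variable power series\<close>

text \<open>The position of \<open>W\<close> between \<open>Min Z\<close> and \<open>Max Z\<close>
  is part of the claim for the sake of the induction: after removal of the largest zero, the new
  Rolle point lies to the right of all earlier ones.\<close>

lemma rolle_zeros:
  fixes f f' :: "real \<Rightarrow> real"
  assumes der: "\<And>t. a < t \<Longrightarrow> t < b \<Longrightarrow> (f has_real_derivative f' t) (at t)"
  shows "finite Z \<Longrightarrow> card Z = Suc m \<Longrightarrow> Z \<subseteq> {t. a < t \<and> t < b \<and> f t = 0} \<Longrightarrow>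
    \<exists>W. finite W \<and> card W = m \<and> W \<subseteq> {t. Min Z < t \<and> t < Max Z \<and> f' t = 0}"
proof (induction m arbitrary: Z)
  case 0
  then show ?case by (intro exI[of _ "{}"]) auto
next
  case (Suc m)
  let ?Z = "Z - {Max Z}"
  have "Z \<noteq> {}" using Suc.prems(2) by auto
  have max: "Max Z \<in> Z" using Suc.prems(1) \<open>Z \<noteq> {}\<close> by simp
  have Z': "finite ?Z" "card ?Z = Suc m" "?Z \<subseteq> {t. a < t \<and> t < b \<and> f t = 0}"
    using Suc.prems max by auto
  then have "?Z \<noteq> {}" by (metis card.empty nat.simps(3))
  obtain W where W: "finite W" "card W = m" "W \<subseteq> {t. Min ?Z < t \<and> t < Max ?Z \<and> f' t = 0}"
    using Suc.IH[OF Z'] by blast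
  have max': "Max ?Z \<in> ?Z" using Z'(1) \<open>?Z \<noteq> {}\<close> by (rule Max_in)
  then have lt: "Max ?Z < Max Z" using Suc.prems(1) by (simp add: order_less_le)
  have ab: "a < Max ?Z" "Max Z < b" "f (Max ?Z) = 0" "f (Max Z) = 0"
    using max max' Suc.prems(3) by auto
  have "\<exists>z. Max ?Z < z \<and> z < Max Z \<and> f' z = 0"
  proof -
    have d: "(f has_real_derivative f' t) (at t)" if "Max ?Z \<le> t" "t \<le> Max Z" for t
      using that ab by (intro der) linarith+
    have "continuous_on {Max ?Z..Max Z} f"
      using d by (intro continuous_at_imp_continuous_on ballI DERIV_isCont) auto
    then obtain z where z: "Max ?Z < z" "z < Max Z" "(*) (f' z) = (\<lambda>v. 0)"
      using Rolle_deriv[OF lt, of f "\<lambda>t. (*) (f' t)"] ab d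
      by (auto simp: has_field_derivative_def)
    from fun_cong[OF z(3), of 1] have "f' z = 0" by simp
    with z(1,2) show ?thesis by blast
  qed
  then obtain z where z: "Max ?Z < z" "z < Max Z" "f' z = 0" by blast
  have "Min Z \<le> Min ?Z" using \<open>?Z \<noteq> {}\<close> Suc.prems(1) by (intro Min_antimono) auto
  moreover have "Min ?Z \<le> Max ?Z" using Z'(1) max' by simp
  moreover have "z \<notin> W" using W(3) z(1) by auto
  moreover have "Min Z < t \<and> t < Max Z \<and> f' t = 0" if "t \<in> insert z W" for t
    using that W(3) z lt calculation by auto
  ultimately show ?case
    using W(1,2) by (intro exI[of _ "insert z W"]) auto
qed

lemma card_zeros_derivative:
  fixes f f' :: "real \<Rightarrow> real"
  assumes der: "\<And>t. a < t \<Longrightarrow> t < b \<Longrightarrow> (f has_real_derivative f' t) (at t)"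
    and fin: "finite {t. a < t \<and> t < b \<and> f' t = 0}"
    and card: "card {t. a < t \<and> t < b \<and> f' t = 0} \<le> n"
  shows "finite {t. a < t \<and> t < b \<and> f t = 0} \<and> card {t. a < t \<and> t < b \<and> f t = 0} \<le> Suc n"
proof -
  let ?S = "{t. a < t \<and> t < b \<and> f t = 0}"
  \<comment> \<open>Excluding finite subsets with n + 2 elements also rules out an infinite zero
    set.\<close>
  have no: False if Z: "finite Z" "card Z = Suc (Suc n)" "Z \<subseteq> ?S" for Z
  proof -
    obtain W where W: "finite W" "card W = Suc n" "W \<subseteq> {t. Min Z < t \<and> t < Max Z \<and> f' t = 0}"
      using rolle_zeros[OF der Z] by blast
    have "Z \<noteq> {}" using Z(2) by auto
    then have "Min Z \<in> ?S" "Max Z \<in> ?S"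
      using Min_in[OF Z(1)] Max_in[OF Z(1)] Z(3) by blast+
    then have "W \<subseteq> {t. a < t \<and> t < b \<and> f' t = 0}" using W(3) by auto
    from card_mono[OF fin this] W(2) card show False by simp
  qed
  have "finite ?S"
    using no infinite_arbitrarily_large[of ?S "Suc (Suc n)"] by blast
  moreover have "card ?S \<le> Suc n"
  proof (rule ccontr)
    assume "\<not> card ?S \<le> Suc n"
    then have "Suc (Suc n) \<le> card ?S" by simp
    then obtain Z where "Z \<subseteq> ?S" "card Z = Suc (Suc n)" "finite Z"
      by (rule obtain_subset_with_card_n)
    with no show False by blast
  qed
  ultimately show ?thesis by blast
qed

text \<open>Termwise differentiation preserves convergence for |t| < r, and each of the n
  applications of Rolle's theorem costs at most one zero.\<close>

lemma card_zeros_powser: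
  fixes b :: "nat \<Rightarrow> real"
  assumes "\<And>t. \<bar>t\<bar> < r \<Longrightarrow> summable (\<lambda>j. b j * t ^ j)"
    and "\<And>t. \<bar>t\<bar> < r \<Longrightarrow> (\<Sum>j. (diffs ^^ n) b j * t ^ j) \<noteq> 0"
  shows "finite {t. - r < t \<and> t < r \<and> (\<Sum>j. b j * t ^ j) = 0} \<and>
    card {t. - r < t \<and> t < r \<and> (\<Sum>j. b j * t ^ j) = 0} \<le> n"
  using assms
proof (induction n arbitrary: b)
  case 0
  then have empty: "{t. - r < t \<and> t < r \<and> (\<Sum>j. b j * t ^ j) = 0} = {}" by (auto simp: abs_less_iff)
  show ?case unfolding empty by simp
next
  case (Suc n)
  have "summable (\<lambda>j. diffs b j * t ^ j)" if "\<bar>t\<bar> < r" for t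
    using termdiff_converges[of t r b] Suc.prems(1) that by simp
  then have IH: "finite {t. - r < t \<and> t < r \<and> (\<Sum>j. diffs b j * t ^ j) = 0} \<and>
    card {t. - r < t \<and> t < r \<and> (\<Sum>j. diffs b j * t ^ j) = 0} \<le> n"
    using Suc.prems(2) by (intro Suc.IH) (simp_all add: funpow_swap1)
  have "((\<lambda>t. \<Sum>j. b j * t ^ j) has_real_derivative (\<Sum>j. diffs b j * t ^ j)) (at t)"
    if "- r < t" "t < r" for t
    using termdiffs_strong'[of r b t] Suc.prems(1) that by (simp add: abs_less_iff)
  then show ?case using IH by (intro card_zeros_derivative) auto
qed

text \<open>The factor (j + q)!/j! from q differentiations is written as q! times a binomial
  coefficient, because the latter is easily bounded by a power of 2.\<close>

lemma diffs_funpow: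
  fixes b :: "nat \<Rightarrow> real"
  shows "(diffs ^^ q) b j = fact q * (real ((j + q) choose q) * b (j + q))"
proof (induction q arbitrary: j)
  case (Suc q)
  have "real (Suc j) * real ((Suc j + q) choose q) = real (Suc q) * real ((j + Suc q) choose Suc q)"
  proof -
    have "Suc q * (Suc (j + q) choose Suc q) = Suc (j + q) * ((j + q) choose q)"
      by (rule Suc_times_binomial_eq[symmetric, simplified mult.commute[of "_ choose _"]])
    moreover have "Suc j * (Suc (j + q) choose q) = Suc (j + q) * ((j + q) choose q)"
      using Suc_times_binomial_eq[of "j + q" j] binomial_symmetric[of q "Suc (j + q)"]
        binomial_symmetric[of q "j + q"]
      by (simp add: Suc_diff_le mult.commute)
    ultimately show ?thesis by (metis add_Suc add_Suc_right of_nat_mult)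
  qed
  note binom = this
  have "(diffs ^^ Suc q) b j = real (Suc j) * (fact q * (real ((Suc j + q) choose q) * b (Suc j + q)))"
    by (simp add: diffs_def Suc.IH del: of_nat_Suc binomial_Suc_Suc)
  also have "\<dots> = (real (Suc j) * real ((Suc j + q) choose q)) * (fact q * b (Suc j + q))"
    by (simp only: mult_ac)
  also have "\<dots> = fact (Suc q) * (real ((j + Suc q) choose Suc q) * b (j + Suc q))"
    unfolding binom by (simp del: of_nat_Suc binomial_Suc_Suc)
  finally show ?case .
qed simp

text \<open>On the interval found, the q-th derivative is q! times b_q plus a tail smaller than
  |b_q|, so it has no zero. Domination is required only from j = 1 on, which leaves the constant
  term free to absorb an arbitrary level.\<close>

lemma uniform_zero_bound:
  fixes A D \<eta>0 :: real
  assumes A: "A \<ge> 0" and D: "D \<ge> 1" and \<eta>0: "\<eta>0 > 0"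
  obtains \<eta> where "0 < \<eta>" "\<eta> \<le> \<eta>0"
    "\<forall>b q. q \<le> K \<longrightarrow> b q \<noteq> 0 \<longrightarrow> (\<forall>j\<ge>1. \<bar>b j\<bar> \<le> A * D ^ j * \<bar>b q\<bar>) \<longrightarrow>
      finite {t. \<bar>t\<bar> < \<eta> \<and> (\<Sum>j. b j * t ^ j) = 0} \<and>
      card {t. \<bar>t\<bar> < \<eta> \<and> (\<Sum>j. b j * t ^ j) = 0} \<le> K"
proof -
  \<comment> \<open>Chosen so that the ratio 2 D |t| is at most 1/2 and the tail bound A (2 D)^K 4 D
    |t| is below 1. Writing A + 1 keeps the denominator positive when A = 0.\<close>
  define \<eta> where "\<eta> = min \<eta>0 (1 / (8 * D * (A + 1) * (2 * D) ^ K))"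
  have pos: "8 * D * (A + 1) * (2 * D) ^ K > 0" using A D by simp
  have D1: "(2 * D) ^ K \<ge> 1" using D by (intro one_le_power) simp
  have small: "2 * D * \<bar>t\<bar> \<le> 1/2" "A * (2 * D) ^ K * (4 * D * \<bar>t\<bar>) < 1" if "\<bar>t\<bar> < \<eta>" for t
  proof -
    have "\<bar>t\<bar> < 1 / (8 * D * (A + 1) * (2 * D) ^ K)" using that by (simp add: \<eta>_def)
    then have *: "(2 * D) ^ K * (A + 1) * (8 * D * \<bar>t\<bar>) < 1"
      using pos by (simp add: less_divide_eq algebra_simps)
    have "1 * 1 * (8 * D * \<bar>t\<bar>) \<le> (2 * D) ^ K * (A + 1) * (8 * D * \<bar>t\<bar>)"
      using D1 A D by (intro mult_mono) auto
    then show "2 * D * \<bar>t\<bar> \<le> 1/2" using * by linarith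
    have "A * (2 * D) ^ K * (4 * D * \<bar>t\<bar>) \<le> (A + 1) * (2 * D) ^ K * (8 * D * \<bar>t\<bar>)"
      using D1 A D by (intro mult_mono) auto
    then show "A * (2 * D) ^ K * (4 * D * \<bar>t\<bar>) < 1" using * by (simp add: mult_ac)
  qed
  show ?thesis
  proof (rule that[of \<eta>], goal_cases)
    case 3
    show ?case
    proof (intro allI impI, goal_cases)
      case (1 b q)
      then have q: "q \<le> K" "b q \<noteq> 0" and b: "\<And>j. 1 \<le> j \<Longrightarrow> \<bar>b j\<bar> \<le> A * D ^ j * \<bar>b q\<bar>"
        by auto
      have summ: "summable (\<lambda>j. b j * t ^ j)" if "\<bar>t\<bar> < \<eta>" for t
      proof (rule summable_comparison_test)
        have "D * \<bar>t\<bar> < 1" using small(1)[OF that] by simp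
        then show "summable (\<lambda>j. A * \<bar>b q\<bar> * (D * \<bar>t\<bar>) ^ j)"
          using D by (intro summable_mult summable_geometric) simp
        have "norm (b j * t ^ j) \<le> A * \<bar>b q\<bar> * (D * \<bar>t\<bar>) ^ j" if "1 \<le> j" for j
          using mult_right_mono[OF b[OF that], of "\<bar>t\<bar> ^ j"]
          by (simp add: abs_mult power_abs power_mult_distrib mult_ac)
        then show "\<exists>N. \<forall>j\<ge>N. norm (b j * t ^ j) \<le> A * \<bar>b q\<bar> * (D * \<bar>t\<bar>) ^ j" by blast
      qed
      have nz: "(\<Sum>j. (diffs ^^ q) b j * t ^ j) \<noteq> 0" if "\<bar>t\<bar> < \<eta>" for t
      proof -
        let ?x = "2 * D * \<bar>t\<bar>" and ?u = "\<lambda>j. real ((j + q) choose q) * b (j + q) * t ^ j"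
        let ?B = "A * (2 * D) ^ q * \<bar>b q\<bar>"
        have x: "0 \<le> ?x" "?x \<le> 1/2" using D small(1)[OF that] by auto
        \<comment> \<open>The bound 2^(j+1+q) for the binomial coefficient and D^(j+1+q) for the
          coefficient combine into a geometric series of ratio 2 D |t|.\<close>
        have le: "norm (?u (Suc j)) \<le> ?B * ?x * ?x ^ j" for j
        proof -
          have c: "real ((Suc j + q) choose q) \<le> 2 ^ (Suc j + q)"
            using of_nat_mono[OF binomial_le_pow2[of "Suc j + q" q], where 'a = real] by simp
          have "norm (?u (Suc j)) = real ((Suc j + q) choose q) * \<bar>b (Suc j + q)\<bar> * \<bar>t\<bar> ^ Suc j"
            by (simp add: abs_mult power_abs)
          also have "\<dots> \<le> 2 ^ (Suc j + q) * (A * D ^ (Suc j + q) * \<bar>b q\<bar>) * \<bar>t\<bar> ^ Suc j"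
            using b[of "Suc j + q"] by (intro mult_mono c) auto
          also have "\<dots> = ?B * ?x * ?x ^ j"
            by (simp add: power_add power_mult_distrib mult_ac)
          finally show ?thesis .
        qed
        have geo: "summable (\<lambda>j. ?B * ?x * ?x ^ j)"
          using x by (intro summable_mult summable_geometric) simp
        have sSuc: "summable (\<lambda>j. norm (?u (Suc j)))"
          by (rule summable_comparison_test'[OF geo]) (use le in auto)
        have "norm (\<Sum>j. ?u (Suc j)) \<le> (\<Sum>j. ?B * ?x * ?x ^ j)"
          by (rule order_trans[OF summable_norm[OF sSuc] suminf_le[OF le sSuc geo]])
        also have "\<dots> = ?B * ?x * (1 / (1 - ?x))"
          using x by (subst suminf_mult) (auto intro: summable_geometric simp: suminf_geometric)
        also have "\<dots> \<le> ?B * ?x * 2"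
          using x A D by (intro mult_left_mono) (auto simp: divide_le_eq)
        also have "\<dots> = (A * (2 * D) ^ q * (4 * D * \<bar>t\<bar>)) * \<bar>b q\<bar>" by (simp add: mult_ac)
        also have "\<dots> \<le> (A * (2 * D) ^ K * (4 * D * \<bar>t\<bar>)) * \<bar>b q\<bar>"
          using A D q(1) by (intro mult_right_mono mult_left_mono power_increasing) auto
        also have "\<dots> < 1 * \<bar>b q\<bar>"
          using small(2)[OF that] q(2) by (intro mult_strict_right_mono) auto
        finally have lt: "\<bar>\<Sum>j. ?u (Suc j)\<bar> < \<bar>b q\<bar>" by simp
        have su: "summable ?u" using summable_norm_cancel[OF sSuc] summable_Suc_iff[of ?u] by blast
        have "(\<Sum>j. (diffs ^^ q) b j * t ^ j) = fact q * (\<Sum>j. ?u j)"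
          using suminf_mult[OF su, of "fact q"] by (simp add: diffs_funpow mult.assoc)
        also have "(\<Sum>j. ?u j) = b q + (\<Sum>j. ?u (Suc j))"
          using suminf_split_head[OF su] by simp
        finally show ?thesis using lt by auto
      qed
      have eq: "{t. \<bar>t\<bar> < \<eta> \<and> (\<Sum>j. b j * t ^ j) = 0} = {t. - \<eta> < t \<and> t < \<eta> \<and> (\<Sum>j. b j * t ^ j) = 0}"
        by (auto simp: abs_less_iff)
      show "finite {t. \<bar>t\<bar> < \<eta> \<and> (\<Sum>j. b j * t ^ j) = 0} \<and>
        card {t. \<bar>t\<bar> < \<eta> \<and> (\<Sum>j. b j * t ^ j) = 0} \<le> K"
        unfolding eq using card_zeros_powser[of \<eta> b q, OF summ nz] q(1) by auto
    qed
  qed (use pos \<eta>0 in \<open>auto simp: \<eta>_def\<close>)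
qed

section \<open>Slices of an analytic function\<close>

lemma polybox_subset_ball:
  assumes "r > 0"
  obtains s where "polybox s \<subseteq> ball (0 :: real ^ 'n::finite) r"
proof -
  have "(\<lambda>s. real CARD('n) * (1 / 2) ^ s) \<longlonglongrightarrow> real CARD('n) * 0"
    by (intro tendsto_mult_left LIMSEQ_power_zero) simp
  then have "\<forall>\<^sub>F s in sequentially. real CARD('n) * (1 / 2) ^ s < r"
    using assms by (intro order_tendstoD(2)) auto
  then obtain s where s: "real CARD('n) * (1 / 2) ^ s < r"
    by (auto simp: eventually_sequentially)
  show ?thesis
  proof (rule that[of s], rule subsetI)
    fix x :: "real ^ 'n" assume x: "x \<in> polybox s"
    have "norm x \<le> (\<Sum>i\<in>UNIV. \<bar>x $ i\<bar>)" by (rule norm_le_l1_cart)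
    also have "\<dots> \<le> (\<Sum>i\<in>(UNIV :: 'n set). (1 / 2) ^ s)"
    proof (rule sum_mono)
      fix i :: 'n
      have "\<bar>x $ i\<bar> \<le> (1 / real (index_prime i)) ^ s"
        using x by (simp add: polybox_def power_one_over)
      also have "\<dots> \<le> (1 / 2) ^ s"
        using prime_ge_2_nat[OF index_prime(2)[of i]]
        by (intro power_mono divide_left_mono) auto
      finally show "\<bar>x $ i\<bar> \<le> (1 / 2) ^ s" .
    qed
    also have "\<dots> < r" using s by simp
    finally show "x \<in> ball 0 r" by simp
  qed
qed

lemma ball_subset_polybox:
  obtains \<eta> where "\<eta> > 0" "ball (0 :: real ^ 'n::finite) \<eta> \<subseteq> polybox s"
    "\<forall>i::'n. \<eta> \<le> 1 / real (index_prime i) ^ s"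
proof -
  let ?R = "range (\<lambda>i::'n. 1 / real (index_prime i) ^ s)"
  have le: "Min ?R \<le> 1 / real (index_prime i) ^ s" for i :: 'n
    by (rule Min_le) auto
  have "Min ?R > 0"
    using prime_gt_0_nat[OF index_prime(2)] by (subst Min_gr_iff) auto
  moreover have "ball (0 :: real ^ 'n) (Min ?R) \<subseteq> polybox s"
  proof
    fix x :: "real ^ 'n" assume "x \<in> ball 0 (Min ?R)"
    then have "norm x < Min ?R" by (simp only: mem_ball_0)
    then have "\<bar>x $ i\<bar> \<le> 1 / real (index_prime i) ^ s" for i
      using component_le_norm_cart[of x i] le[of i] by linarith
    then show "x \<in> polybox s" by (simp add: polybox_def)
  qed
  ultimately show ?thesis using le by (intro that) auto
qed

text \<open>Once a polybox fits into the ball of convergence, its corner \<open>v\<close> is a point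
  of summability at which the monomials equal the weights; for reals, unconditional summability
  there is absolute, and this is \<open>conv\<close>.\<close>

lemma real_analytic_pseries:
  fixes f :: "real ^ 'n::finite \<Rightarrow> real" and U :: "(real ^ 'n) set"
  assumes "real_analytic_at f 0" "open U" "0 \<in> U"
  obtains c s where "conv s c" "polybox s \<subseteq> U" "\<And>x. x \<in> polybox s \<Longrightarrow> f x = pseries c x"
proof -
  obtain r c where r: "r > 0"
    and c: "\<And>x. x \<in> ball 0 r \<Longrightarrow> ((\<lambda>\<alpha>. c \<alpha> * monomial x \<alpha>) has_sum f x) UNIV"
  proof -
    from assms(1) show ?thesis
      unfolding real_analytic_at_def monomial_def[symmetric] zero_index diff_zero
      using that by blast
  qed
  obtain r' where r': "r' > 0" "ball 0 r' \<subseteq> U"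
    using assms(2,3) by (auto simp: open_contains_ball)
  obtain s where s: "polybox s \<subseteq> ball (0 :: real ^ 'n) (min r r')"
    using polybox_subset_ball[of "min r r'"] r r' by auto
  define v :: "real ^ 'n" where "v = (\<chi> i. 1 / real (index_prime i) ^ s)"
  have "monomial v \<alpha> = wt s \<alpha>" for \<alpha>
    by (simp add: monomial_def v_def wt_def godel_def prod_dividef prod_power_distrib power_divide
        flip: power_mult) (simp add: mult.commute)
  moreover have "v \<in> polybox s" by (simp add: polybox_def v_def)
  ultimately have "(\<lambda>\<alpha>. c \<alpha> * wt s \<alpha>) summable_on UNIV"
    using c[of v] subsetD[OF s, of v] by (auto simp: summable_on_def)
  then have "conv s c"
    by (subst (asm) summable_on_iff_abs_summable_on_real) (simp add: conv_def abs_mult)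
  moreover have "f x = pseries c x" if "x \<in> polybox s" for x
    using c[of x] s that by (auto simp: pseries_def infsumI)
  moreover have "polybox s \<subseteq> U"
    using s r'(2) subset_ball[OF min.cobounded2[of r r'], of 0] by blast
  ultimately show ?thesis using that by blast
qed

text \<open>The coefficient of $x_k^j$, kept as a series in all variables in which $x_k$ does not occur.\<close>

definition slice :: "'n \<Rightarrow> (('n \<Rightarrow> nat) \<Rightarrow> real) \<Rightarrow> nat \<Rightarrow> ('n \<Rightarrow> nat) \<Rightarrow> real" where
  "slice k c j \<alpha> = (if \<alpha> k = 0 then c (\<alpha>(k := j)) else 0)"

lemma upd_eq_add: "\<alpha> k = 0 \<Longrightarrow> \<alpha>(k := j) = (\<lambda>i. \<alpha> i + (if i = k then j else (0::nat)))"
  by (auto simp: fun_eq_iff)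

lemma prod_power_delta:
  fixes g :: "'n::finite \<Rightarrow> 'a::comm_semiring_1"
  shows "(\<Prod>i\<in>UNIV. g i ^ (if i = k then j else 0)) = g k ^ j"
proof -
  have "(\<Prod>i\<in>UNIV. g i ^ (if i = k then j else 0)) = (\<Prod>i\<in>UNIV. if i = k then g k ^ j else 1)"
    by (intro prod.cong) auto
  then show ?thesis by simp
qed

lemma wt_upd:
  assumes "\<alpha> k = 0"
  shows "wt s \<alpha> = (real (index_prime k) ^ s) ^ j * wt s (\<alpha>(k := j))"
proof -
  have "wt s (\<alpha>(k := j)) = wt s \<alpha> * (1 / (real (index_prime k) ^ j) ^ s)"
    unfolding upd_eq_add[of \<alpha> k j, OF assms] wt_add by (simp add: wt_def godel_def prod_power_delta)
  moreover have "(real (index_prime k) ^ j) ^ s = (real (index_prime k) ^ s) ^ j"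
    by (simp add: mult.commute flip: power_mult)
  ultimately show ?thesis
    using prime_gt_0_nat[OF index_prime(2)[of k]] by simp
qed

text \<open>A slice reuses part of the coefficients of \<open>c\<close>, but removing the factor
  x_k^j enlarges each weight by p_k^(s j). This is the source of the geometric growth in
  \<open>j\<close> of the coefficient estimate.\<close>

lemma slice_conv:
  fixes c :: "('n::finite \<Rightarrow> nat) \<Rightarrow> real"
  assumes "conv s c"
  shows "conv s (slice k c j)" "wnorm s (slice k c j) \<le> (real (index_prime k) ^ s) ^ j * wnorm s c"
proof -
  let ?A = "{\<alpha> :: 'n \<Rightarrow> nat. \<alpha> k = 0}" and ?u = "\<lambda>\<alpha>::'n \<Rightarrow> nat. \<alpha>(k := j)"
  let ?D = "(real (index_prime k) ^ s) ^ j" and ?h = "\<lambda>\<alpha>. \<bar>c \<alpha>\<bar> * wt s \<alpha>"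
  have inj: "inj_on ?u ?A"
  proof (rule inj_onI)
    fix \<alpha> \<beta> assume *: "\<alpha> \<in> ?A" "\<beta> \<in> ?A" "?u \<alpha> = ?u \<beta>"
    show "\<alpha> = \<beta>"
    proof
      show "\<alpha> i = \<beta> i" for i
        using *(1,2) fun_cong[OF *(3), of i] by (cases "i = k") auto
    qed
  qed
  have c: "?h summable_on UNIV" using assms by (simp add: conv_def)
  then have ci: "?h summable_on ?u ` ?A" by (rule summable_on_subset_banach) simp
  then have hs: "((\<lambda>\<alpha>. ?h (?u \<alpha>)) has_sum infsum ?h (?u ` ?A)) ?A"
    using has_sum_reindex[OF inj, of ?h] has_sum_infsum[OF ci] by (simp add: o_def)
  have "((\<lambda>\<alpha>. ?D * ?h (?u \<alpha>)) has_sum ?D * infsum ?h (?u ` ?A)) ?A"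
    using hs by (rule has_sum_cmult_right)
  moreover have "((\<lambda>\<alpha>. \<bar>slice k c j \<alpha>\<bar> * wt s \<alpha>) has_sum a) UNIV \<longleftrightarrow>
      ((\<lambda>\<alpha>. ?D * ?h (?u \<alpha>)) has_sum a) ?A" for a
    by (rule has_sum_cong_neutral) (auto simp: slice_def wt_upd[where j = j and k = k])
  ultimately have hs': "((\<lambda>\<alpha>. \<bar>slice k c j \<alpha>\<bar> * wt s \<alpha>) has_sum ?D * infsum ?h (?u ` ?A)) UNIV"
    by simp
  then show "conv s (slice k c j)" by (auto simp: conv_def summable_on_def)
  have "wnorm s (slice k c j) = ?D * infsum ?h (?u ` ?A)"
    unfolding wnorm_def using hs' by (rule infsumI)
  also have "\<dots> \<le> ?D * wnorm s c"
    unfolding wnorm_def by (intro mult_left_mono infsum_mono2 ci c) auto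
  finally show "wnorm s (slice k c j) \<le> ?D * wnorm s c" .
qed

lemma pseries_slices:
  assumes c: "conv s c" and y: "y \<in> polybox s" "y $ k = 0"
    and t: "\<bar>t\<bar> \<le> 1 / real (index_prime k) ^ s"
  shows "y + axis k t \<in> polybox s"
    and "(\<lambda>j. pseries (slice k c j) y * t ^ j) sums pseries c (y + axis k t)"
proof -
  let ?x = "y + axis k t" and ?A = "{\<alpha>. \<alpha> k = (0::nat)}"
  have comp: "?x $ i = (if i = k then t else y $ i)" for i
    using y(2) by (simp add: axis_def)
  show x: "?x \<in> polybox s"
    using y(1) t unfolding polybox_def by (auto simp: comp simp del: vector_add_component)
  have mon: "monomial ?x (\<alpha>(k := j)) = monomial y \<alpha> * t ^ j" if "\<alpha> k = 0" for \<alpha> j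
  proof -
    have "monomial ?x \<alpha> = monomial y \<alpha>"
      unfolding monomial_def using that by (intro prod.cong) (auto simp: comp simp del: vector_add_component)
    moreover have "monomial ?x (\<lambda>i. if i = k then j else 0) = t ^ j"
      unfolding monomial_def prod_power_delta by (simp add: comp del: vector_add_component)
    ultimately show ?thesis unfolding upd_eq_add[of \<alpha> k j, OF that] monomial_add by simp
  qed
  have "((\<lambda>\<alpha>. c \<alpha> * monomial ?x \<alpha>) has_sum pseries c ?x) UNIV"
    unfolding pseries_def by (intro has_sum_infsum pseries_summable[OF c x])
  \<comment> \<open>A multi-index is split into its entry at \<open>k\<close> and the multi-index
    with that entry set to 0; unconditional summation permits grouping by the first
    component.\<close>
  also have "?this \<longleftrightarrow> ((\<lambda>(j, \<alpha>). c (\<alpha>(k := j)) * (monomial y \<alpha> * t ^ j)) has_sum pseries c ?x) (UNIV \<times> ?A)"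
    by (rule has_sum_reindex_bij_witness[where i = "\<lambda>(j, \<alpha>). \<alpha>(k := j)" and j = "\<lambda>\<alpha>. (\<alpha> k, \<alpha>(k := 0))"])
       (auto simp: mon[symmetric])
  finally have hs: "((\<lambda>(j, \<alpha>). c (\<alpha>(k := j)) * (monomial y \<alpha> * t ^ j)) has_sum pseries c ?x) (UNIV \<times> ?A)" .
  have "((\<lambda>\<alpha>. c (\<alpha>(k := j)) * (monomial y \<alpha> * t ^ j)) has_sum pseries (slice k c j) y * t ^ j) ?A" for j
  proof -
    have "((\<lambda>\<alpha>. slice k c j \<alpha> * monomial y \<alpha> * t ^ j) has_sum pseries (slice k c j) y * t ^ j) UNIV"
      unfolding pseries_def
      by (intro has_sum_cmult_left has_sum_infsum pseries_summable[OF slice_conv(1)[OF c] y(1)])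
    then show ?thesis
      by (rule has_sum_cong_neutral[THEN iffD1, rotated -1]) (auto simp: slice_def)
  qed
  then have "((\<lambda>j. pseries (slice k c j) y * t ^ j) has_sum pseries c ?x) UNIV"
    using has_sum_SigmaD[OF hs] by simp
  then show "(\<lambda>j. pseries (slice k c j) y * t ^ j) sums pseries c ?x"
    by (rule has_sum_imp_sums)
qed

section \<open>Uniform bound for level sets on segments parallel to a coordinate axis\<close>

theorem corollary2p1p1:
  fixes f :: "real ^ 'n \<Rightarrow> real" and U :: "(real ^ 'n) set" and k :: 'n
  assumes "open U" and "0 \<in> U"
    and "real_analytic_on f U"
    and "\<exists>x\<in>U. f x \<noteq> 0"
  shows "\<exists>(\<eta>::real) (p::nat). \<eta> > 0 \<and> p > 0 \<and>
    (\<forall>y \<in> base_ball k \<eta>. \<forall>t. \<bar>t\<bar> < \<eta> \<longrightarrow> y + axis k t \<in> U) \<and>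
    (\<forall>y \<in> base_ball k \<eta>. \<forall>s::real.
       (\<forall>t. \<bar>t\<bar> < \<eta> \<longrightarrow> f (y + axis k t) = s) \<or>
       (finite {t. \<bar>t\<bar> < \<eta> \<and> f (y + axis k t) = s} \<and>
        card {t. \<bar>t\<bar> < \<eta> \<and> f (y + axis k t) = s} \<le> p))"
proof -
  have f: "real_analytic_at f 0" using assms(2,3) by (simp add: real_analytic_on_def)
  obtain c \<sigma>0 where c0: "conv \<sigma>0 c"
    "polybox \<sigma>0 \<subseteq> U" "\<And>x. x \<in> polybox \<sigma>0 \<Longrightarrow> f x = pseries c x"
    by (rule real_analytic_pseries[OF f assms(1,2)], rule that)
  define a where "a = slice k c"
  \<comment> \<open>The index 0 is omitted because subtracting the level from f alters exactly that
    coefficient. A sum replaces the maximum of the |a_j|.\<close>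
  define V where "V K y = (\<Sum>j=1..K. \<bar>pseries (a j) y\<bar>)" for K y
  have V0: "V K y \<ge> 0" for K y by (simp add: V_def sum_nonneg)
  have Vinc: "incseq (\<lambda>K. V K y)" for y
    unfolding V_def by (intro incseq_SucI) simp
  obtain \<sigma> K C where \<sigma>: "\<sigma>0 \<le> \<sigma>" and C: "C \<ge> 0"
    and dom: "\<And>h x. dominated V h \<Longrightarrow> conv \<sigma> h \<Longrightarrow> x \<in> polybox \<sigma> \<Longrightarrow>
      \<bar>pseries h x\<bar> \<le> C * wnorm \<sigma> h * V K x"
    by (rule dominated_uniform[of V \<sigma>0, OF V0 Vinc], rule that)
  have c: "conv \<sigma> c" by (rule conv_mono[OF c0(1) \<sigma>])
  define D where "D = real (index_prime k) ^ \<sigma>"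
  have D: "D \<ge> 1"
    unfolding D_def using prime_ge_1_nat[OF index_prime(2)[of k]] by (intro one_le_power) simp
  \<comment> \<open>The factor \<open>real K\<close> pays for bounding the sum \<open>V K y\<close>
    by its largest term.\<close>
  define A where "A = C * wnorm \<sigma> c * real K"
  have A: "A \<ge> 0" by (simp add: A_def C wnorm_nonneg)
  have coeff: "\<bar>pseries (a j) y\<bar> \<le> C * wnorm \<sigma> c * D ^ j * V K y"
    if "1 \<le> j" "y \<in> polybox \<sigma>" for j y
  proof -
    \<comment> \<open>Trivial with the index \<open>j\<close> itself, since |a_j| is a summand of
      \<open>V j\<close>; the content of \<open>dom\<close> is the passage to the fixed index
      \<open>K\<close>.\<close>
    have "dominated V (a j)"
      unfolding dominated_def
    proof (intro exI conjI ballI)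
      show "conv \<sigma> (a j)" unfolding a_def by (rule slice_conv(1)[OF c])
      show "\<bar>pseries (a j) x\<bar> \<le> 1 * V j x" for x
        unfolding V_def using that(1) member_le_sum[of j "{1..j}" "\<lambda>j. \<bar>pseries (a j) x\<bar>"] by simp
    qed
    then have "\<bar>pseries (a j) y\<bar> \<le> C * wnorm \<sigma> (a j) * V K y"
      using dom slice_conv(1)[OF c] that(2) by (simp add: a_def)
    also have "\<dots> \<le> C * (D ^ j * wnorm \<sigma> c) * V K y"
      unfolding a_def D_def by (intro mult_right_mono mult_left_mono slice_conv c C V0)
    finally show ?thesis by (simp add: mult_ac)
  qed
  obtain \<eta>0 where \<eta>0: "\<eta>0 > 0" "ball (0 :: real ^ 'n) \<eta>0 \<subseteq> polybox \<sigma>"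
    "\<forall>i::'n. \<eta>0 \<le> 1 / real (index_prime i) ^ \<sigma>"
    using ball_subset_polybox by blast
  obtain \<eta> where \<eta>: "0 < \<eta>" "\<eta> \<le> \<eta>0"
    and zeros: "\<forall>b q. q \<le> K \<longrightarrow> b q \<noteq> 0 \<longrightarrow> (\<forall>j\<ge>1. \<bar>b j\<bar> \<le> A * D ^ j * \<bar>b q\<bar>) \<longrightarrow>
      finite {t. \<bar>t\<bar> < \<eta> \<and> (\<Sum>j. b j * t ^ j) = 0} \<and>
      card {t. \<bar>t\<bar> < \<eta> \<and> (\<Sum>j. b j * t ^ j) = 0} \<le> K"
    using uniform_zero_bound[OF A D \<eta>0(1), of K] by blast
  have y: "y \<in> polybox \<sigma>" "y $ k = 0" if "y \<in> base_ball k \<eta>" for y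
    using that \<eta>(2) \<eta>0(2) by (auto simp: base_ball_def)
  have t: "\<bar>t\<bar> \<le> 1 / real (index_prime k) ^ \<sigma>" if "\<bar>t\<bar> < \<eta>" for t
    using that \<eta>(2) spec[OF \<eta>0(3), of k] by linarith
  have box: "y + axis k t \<in> polybox \<sigma>0" if "y \<in> base_ball k \<eta>" "\<bar>t\<bar> < \<eta>" for y t
    using pseries_slices(1)[OF c y[OF that(1)] t[OF that(2)]] polybox_mono[OF \<sigma>] by blast
  have f_sums: "(\<lambda>j. pseries (a j) y * t ^ j) sums f (y + axis k t)"
    if "y \<in> base_ball k \<eta>" "\<bar>t\<bar> < \<eta>" for y t
    using pseries_slices(2)[OF c y[OF that(1)] t[OF that(2)]] c0(3)[OF box[OF that]]
    by (simp add: a_def)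
  have "(\<forall>t. \<bar>t\<bar> < \<eta> \<longrightarrow> f (y + axis k t) = s) \<or>
       (finite {t. \<bar>t\<bar> < \<eta> \<and> f (y + axis k t) = s} \<and>
        card {t. \<bar>t\<bar> < \<eta> \<and> f (y + axis k t) = s} \<le> Suc K)"
    if yb: "y \<in> base_ball k \<eta>" for y s
  proof (cases "V K y = 0")
    case True
    then have "pseries (a j) y = 0" if "1 \<le> j" for j
      using coeff[OF that y(1)[OF yb]] by simp
    then have "f (y + axis k t) = pseries (a 0) y" if "\<bar>t\<bar> < \<eta>" for t
      using f_sums[OF yb that] sums_finite[of "{0}" "\<lambda>j. pseries (a j) y * t ^ j"]
      by (auto intro: sums_unique2)
    \<comment> \<open>Here \<open>coeff\<close> annihilates all a_j(y) with j at least 1, so f is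
      constant on the segment and each level set is everything or empty.\<close>
    then have "{t. \<bar>t\<bar> < \<eta> \<and> f (y + axis k t) = s} =
        (if s = pseries (a 0) y then {t. \<bar>t\<bar> < \<eta>} else {})" by auto
    then show ?thesis by (auto split: if_splits)
  next
    case False
    \<comment> \<open>Only the constant term depends on \<open>s\<close>, whereas the maximal
      coefficient b_q is sought among the indices 1 to \<open>K\<close>; hence the zero bound is
      uniform in \<open>s\<close>.\<close>
    define b where "b j = (if j = 0 then pseries (a 0) y - s else pseries (a j) y)" for j
    have "K \<noteq> 0" using False by (cases K) (simp_all add: V_def)
    then have "Max ((\<lambda>j. \<bar>b j\<bar>) ` {1..K}) \<in> (\<lambda>j. \<bar>b j\<bar>) ` {1..K}"
      by (intro Max_in) (simp_all add: Suc_le_eq)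
    then obtain q where q: "q \<in> {1..K}" "Max ((\<lambda>j. \<bar>b j\<bar>) ` {1..K}) = \<bar>b q\<bar>"
      by blast
    have q_max: "\<bar>b j\<bar> \<le> \<bar>b q\<bar>" if "j \<in> {1..K}" for j
      using that unfolding q(2)[symmetric] by (intro Max_ge) simp_all
    have "V K y = (\<Sum>j=1..K. \<bar>b j\<bar>)" unfolding V_def by (intro sum.cong) (auto simp: b_def)
    also have "\<dots> \<le> real K * \<bar>b q\<bar>"
      using sum_bounded_above[of "{1..K}" "\<lambda>j. \<bar>b j\<bar>" "\<bar>b q\<bar>"] q_max by simp
    finally have V: "V K y \<le> real K * \<bar>b q\<bar>" .
    have "b q \<noteq> 0" using V False V0[of K y] by auto
    moreover have "\<bar>b j\<bar> \<le> A * D ^ j * \<bar>b q\<bar>" if "1 \<le> j" for j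
    proof -
      have "\<bar>b j\<bar> \<le> C * wnorm \<sigma> c * D ^ j * V K y"
        using coeff[OF that y(1)[OF yb]] that by (simp add: b_def)
      also have "\<dots> \<le> C * wnorm \<sigma> c * D ^ j * (real K * \<bar>b q\<bar>)"
        using C D by (intro mult_left_mono V mult_nonneg_nonneg wnorm_nonneg) auto
      finally show ?thesis by (simp add: A_def mult_ac)
    qed
    ultimately have *: "finite {t. \<bar>t\<bar> < \<eta> \<and> (\<Sum>j. b j * t ^ j) = 0} \<and>
      card {t. \<bar>t\<bar> < \<eta> \<and> (\<Sum>j. b j * t ^ j) = 0} \<le> K"
      using q(1) by (intro zeros[rule_format]) auto
    have "(\<Sum>j. b j * t ^ j) = f (y + axis k t) - s" if "\<bar>t\<bar> < \<eta>" for t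
    proof -
      have "(\<lambda>j. pseries (a j) y * t ^ j - (if j = 0 then s else 0)) sums (f (y + axis k t) - s)"
        by (intro sums_diff f_sums[OF yb that] sums_single)
      moreover have "b j * t ^ j = pseries (a j) y * t ^ j - (if j = 0 then s else 0)" for j
        by (simp add: b_def)
      ultimately show ?thesis by (simp add: sums_unique[symmetric])
    qed
    then have "{t. \<bar>t\<bar> < \<eta> \<and> f (y + axis k t) = s} = {t. \<bar>t\<bar> < \<eta> \<and> (\<Sum>j. b j * t ^ j) = 0}"
      by auto
    with * show ?thesis by simp
  qed
  moreover have "\<forall>y \<in> base_ball k \<eta>. \<forall>t. \<bar>t\<bar> < \<eta> \<longrightarrow> y + axis k t \<in> U"
    using box c0(2) by blast
  \<comment> \<open>\<open>Suc K\<close> rather than \<open>K\<close> keeps p positive even when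
    \<open>K\<close> is 0.\<close>
  ultimately show ?thesis using \<eta>(1) by (intro exI[of _ \<eta>] exI[of _ "Suc K"]) auto
qed

end
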